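(* Let $n\in\mathbb{N}$, let $m\in\mathbb{R}$, and assume that $a\in S^{m}(\mathbb{Z}^n\times\mathbb{T}^n)$. Let $\varphi\in RO$. Then the pseudo-differential operator $T_a$ extends to a bounded linear operator $$T_a\colon H^{\varphi}(\mathbb{Z}^n)\to H^{t^{-m}\varphi}(\mathbb{Z}^n),$$ where $t^{-m}\varphi$ denotes the product of the functions $t\mapsto t^{-m}$ and $\varphi$.
   Context: Notation on $\mathbb{Z}^n$: $|k|=\sqrt{k_1^2+\dots+k_n^2}$ and $\langle k\rangle=(1+|k|^2)^{1/2}$; $\mathbb{T}^n=\mathbb{R}^n/\mathbb{Z}^n$. $\ell^2(\mathbb{Z}^n)$ is the Hilbert space of square summable functions $u\colon\mathbb{Z}^n\to\mathbb{C}$ with inner product $(u,v)=\sum_{k\in\mathbb{Z}^n}u(k)\overline{v(k)}$. $\Delta_{k_j}u(k)=u(k+e_j)-u(k)$ and $\Delta_k^\alpha=\Delta_{k_1}^{\alpha_1}\cdots\Delta_{k_n}^{\alpha_n}$ for $\alpha\in\mathbb{N}_0^n$, where $e_j$ is the $j$-th standard unit vector; $|\alpha|=\alpha_1+\dots+\alpha_n$. $\mathcal{S}(\mathbb{Z}^n)$ is the Schwartz space of functions $u\colon\mathbb{Z}^n\to\mathbb{C}$ with $\sup_{k}|k^{\alpha}(\Delta_k^{\beta}u)(k)|<\infty$ for all $\alpha,\beta\in\mathbb{N}_0^n$. $\mathcal{S}'(\mathbb{Z}^n)$ is the space of continuous linear functionals on $\mathcal{S}(\mathbb{Z}^n)$,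 identified with functions $u\colon\mathbb{Z}^n\to\mathbb{C}$ of at most polynomial growth acting by $v\mapsto\sum_k u(k)v(k)$. $RO$-varying functions: $\varphi\in RO$ means that $\varphi\colon[1,\infty)\to(0,\infty)$ is Borel measurable and there exist $a>1$, $c\geq1$ with $c^{-1}\leq\varphi(\lambda t)/\varphi(t)\leq c$ for all $t\geq1$, $\lambda\in[1,a]$. For $\varphi\in RO$, $H^{\varphi}(\mathbb{Z}^n)=\{u\in\mathcal{S}'(\mathbb{Z}^n):\varphi(\langle k\rangle)u\in\ell^2(\mathbb{Z}^n)\}$ with inner product $(u,v)_{H^{\varphi}(\mathbb{Z}^n)}=\sum_{k\in\mathbb{Z}^n}[\varphi(\langle k\rangle)]^2u(k)\overline{v(k)}$. Symbols: for $l\in\mathbb{N}_0$, $D_{x_j}^{(l)}=\prod_{r=0}^{l-1}\left(\frac{1}{2\pi i}\frac{\partial}{\partial x_j}-r\right)$, $D_{x_j}^{(0)}=1$ (identity), and $D_x^{(\beta)}=D_{x_1}^{(\beta_1)}\cdots D_{x_n}^{(\beta_n)}$. For $m\in\mathbb{R}$, $S^m(\mathbb{Z}^n\times\mathbb{T}^n)$ is the set of functions $a\colon\mathbb{Z}^n\times\mathbb{T}^n\to\mathbb{C}$ such that $a(k,\cdot)\in C^\infty(\mathbb{T}^n)$ for all $k\in\mathbb{Z}^n$ and for all $\alpha,\beta\in\mathbb{N}_0^n$ there is $C_{\alpha,\beta}>0$ with $|D_x^{(\beta)}\Delta_k^\alpha a(k,x)|\leq C_{\alpha,\beta}(1+|k|)^{m-|\alpha|}$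 for all $(k,x)\in\mathbb{Z}^n\times\mathbb{T}^n$. Pseudo-differential operators: $\widehat{u}(x)=\sum_{k\in\mathbb{Z}^n}e^{-2\pi ik\cdot x}u(k)$, $x\in\mathbb{T}^n$. For $a\in S^m(\mathbb{Z}^n\times\mathbb{T}^n)$, $(T_au)(k)=\int_{\mathbb{T}^n}e^{2\pi ik\cdot x}a(k,x)\widehat{u}(x)\,dx$ for $u\in\mathcal{S}(\mathbb{Z}^n)$; it maps $\mathcal{S}(\mathbb{Z}^n)$ into $\mathcal{S}(\mathbb{Z}^n)$. Its formal adjoint $T_a^\dagger\colon\mathcal{S}(\mathbb{Z}^n)\to\mathcal{S}(\mathbb{Z}^n)$ is defined by $(T_au,v)=(u,T_a^\dagger v)$ for $u,v\in\mathcal{S}(\mathbb{Z}^n)$, and $T_a$ extends to $T_a\colon\mathcal{S}'(\mathbb{Z}^n)\to\mathcal{S}'(\mathbb{Z}^n)$ by $(T_aF)(\overline{u})=F(\overline{T_a^\dagger u})$, $F\in\mathcal{S}'(\mathbb{Z}^n)$, $u\in\mathcal{S}(\mathbb{Z}^n)$. *)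

theory Defs
  imports "HOL-Analysis.Analysis"
begin

text \<open>
  The lattice \<open>\<int>\<^sup>n\<close> is \<open>int ^ 'n\<close> with \<open>n = CARD('n) \<ge> 1\<close>. Functions on the torus
  \<open>\<real>\<^sup>n / \<int>\<^sup>n\<close> are functions on \<open>real ^ 'n\<close> with period 1 in each variable, and the integral
  over the torus is the integral over the unit cube.
\<close>

definition real_vec :: "int ^ 'n \<Rightarrow> real ^ 'n" where
  "real_vec k = (\<chi> j. real_of_int (k $ j))"

definition lnorm :: "int ^ 'n::finite \<Rightarrow> real" where
  "lnorm k = norm (real_vec k)"

definition japanese :: "int ^ 'n::finite \<Rightarrow> real" where
  "japanese k = sqrt (1 + (lnorm k)\<^sup>2)"

definition multi_order :: "nat ^ 'n::finite \<Rightarrow> nat" where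
  "multi_order \<alpha> = (\<Sum>j\<in>UNIV. \<alpha> $ j)"

text \<open>
  An enumeration of the coordinates, needed to write down the compositions
  \<open>\<Delta>\<^sub>1\<^sup>\<alpha>\<^sup>1 \<dots> \<Delta>\<^sub>n\<^sup>\<alpha>\<^sup>n\<close> and \<open>D\<^sub>1 \<dots> D\<^sub>n\<close>. The factors commute (the latter on smooth
  functions), so the choice of the enumeration is immaterial.
\<close>

definition coords :: "'n::finite list" where
  "coords = (SOME js. distinct js \<and> set js = UNIV)"


subsection \<open>Sequence spaces\<close>

definition lattice_diff :: "'n::finite \<Rightarrow> (int ^ 'n \<Rightarrow> complex) \<Rightarrow> int ^ 'n \<Rightarrow> complex" where
  "lattice_diff j u = (\<lambda>k. u (k + axis j 1) - u k)"

definition multi_diff :: "nat ^ 'n::finite \<Rightarrow> (int ^ 'n \<Rightarrow> complex) \<Rightarrow> int ^ 'n \<Rightarrow> complex" where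
  "multi_diff \<alpha> u = foldr (\<lambda>j. lattice_diff j ^^ (\<alpha> $ j)) coords u"

definition ell2 :: "(int ^ 'n::finite \<Rightarrow> complex) set" where
  "ell2 = {u. (\<lambda>k. (cmod (u k))\<^sup>2) summable_on UNIV}"

definition ell2_inner :: "(int ^ 'n::finite \<Rightarrow> complex) \<Rightarrow> (int ^ 'n \<Rightarrow> complex) \<Rightarrow> complex" where
  "ell2_inner u v = (\<Sum>\<^sub>\<infinity>k. u k * cnj (v k))"

definition schwartz :: "(int ^ 'n::finite \<Rightarrow> complex) set" where
  "schwartz = {u. \<forall>\<alpha> \<beta>. bdd_above
     (range (\<lambda>k. cmod (of_int (\<Prod>j\<in>UNIV. (k $ j) ^ (\<alpha> $ j)) * multi_diff \<beta> u k)))}"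

text \<open>
  Tempered distributions on the lattice, identified as usual with the functions of at most
  polynomial growth; such a function acts on the Schwartz space by \<open>dual_pairing\<close>.
\<close>

definition tempered :: "(int ^ 'n::finite \<Rightarrow> complex) set" where
  "tempered = {u. \<exists>C N. \<forall>k. cmod (u k) \<le> C * (1 + lnorm k) ^ (N::nat)}"

definition dual_pairing :: "(int ^ 'n::finite \<Rightarrow> complex) \<Rightarrow> (int ^ 'n \<Rightarrow> complex) \<Rightarrow> complex" where
  "dual_pairing u v = (\<Sum>\<^sub>\<infinity>k. u k * v k)"


subsection \<open>RO-varying functions and the associated Hilbert spaces\<close>

text \<open>Only the values on \<open>{1..}\<close> of a function in \<open>RO\<close> are relevant.\<close>

definition RO :: "(real \<Rightarrow> real) set" where
  "RO = {\<phi>. \<phi> \<in> borel_measurable (restrict_space borel {1..}) \<and> (\<forall>t\<ge>1. \<phi> t > 0) \<and>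
     (\<exists>a>1. \<exists>c\<ge>1. \<forall>t\<ge>1. \<forall>s\<in>{1..a}. inverse c \<le> \<phi> (s * t) / \<phi> t \<and> \<phi> (s * t) / \<phi> t \<le> c)}"

definition Hspace :: "(real \<Rightarrow> real) \<Rightarrow> (int ^ 'n::finite \<Rightarrow> complex) set" where
  "Hspace \<phi> = {u \<in> tempered. (\<lambda>k. of_real (\<phi> (japanese k)) * u k) \<in> ell2}"

definition Hinner ::
    "(real \<Rightarrow> real) \<Rightarrow> (int ^ 'n::finite \<Rightarrow> complex) \<Rightarrow> (int ^ 'n \<Rightarrow> complex) \<Rightarrow> complex" where
  "Hinner \<phi> u v = (\<Sum>\<^sub>\<infinity>k. of_real ((\<phi> (japanese k))\<^sup>2) * u k * cnj (v k))"

definition Hnorm :: "(real \<Rightarrow> real) \<Rightarrow> (int ^ 'n::finite \<Rightarrow> complex) \<Rightarrow> real" where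
  "Hnorm \<phi> u = sqrt (Re (Hinner \<phi> u u))"


subsection \<open>Symbols\<close>

definition partial :: "'n::finite \<Rightarrow> (real ^ 'n \<Rightarrow> complex) \<Rightarrow> real ^ 'n \<Rightarrow> complex" where
  "partial j f = (\<lambda>x. vector_derivative (\<lambda>t. f (x + t *\<^sub>R axis j 1)) (at 0))"

text \<open>
  Since \<open>vector_derivative\<close> is total, the existence of each iterated partial derivative
  has to be required separately.
\<close>

definition smooth :: "(real ^ 'n::finite \<Rightarrow> complex) \<Rightarrow> bool" where
  "smooth f \<longleftrightarrow> (\<forall>js. continuous_on UNIV (foldr partial js f) \<and>
     (\<forall>j x. (\<lambda>t. foldr partial js f (x + t *\<^sub>R axis j 1)) differentiable (at 0)))"

definition smooth_torus :: "(real ^ 'n::finite \<Rightarrow> complex) set" where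
  "smooth_torus = {f. smooth f \<and> (\<forall>j x. f (x + axis j 1) = f x)}"

primrec Dx :: "'n::finite \<Rightarrow> nat \<Rightarrow> (real ^ 'n \<Rightarrow> complex) \<Rightarrow> real ^ 'n \<Rightarrow> complex" where
  "Dx j 0 f = f"
| "Dx j (Suc l) f = (\<lambda>x. 1 / (2 * of_real pi * \<i>) * partial j (Dx j l f) x - of_nat l * Dx j l f x)"

definition multi_Dx :: "nat ^ 'n::finite \<Rightarrow> (real ^ 'n \<Rightarrow> complex) \<Rightarrow> real ^ 'n \<Rightarrow> complex" where
  "multi_Dx \<beta> f = foldr (\<lambda>j. Dx j (\<beta> $ j)) coords f"

definition symbol_class :: "real \<Rightarrow> (int ^ 'n::finite \<Rightarrow> real ^ 'n \<Rightarrow> complex) set" where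
  "symbol_class m = {a. (\<forall>k. a k \<in> smooth_torus) \<and>
     (\<forall>\<alpha> \<beta>. \<exists>C>0. \<forall>k x. cmod (multi_Dx \<beta> (\<lambda>y. multi_diff \<alpha> (\<lambda>l. a l y) k) x)
        \<le> C * (1 + lnorm k) powr (m - real (multi_order \<alpha>)))}"


subsection \<open>Pseudo-differential operators\<close>

definition fourier :: "(int ^ 'n::finite \<Rightarrow> complex) \<Rightarrow> real ^ 'n \<Rightarrow> complex" where
  "fourier u x = (\<Sum>\<^sub>\<infinity>k. exp (- 2 * of_real pi * \<i> * of_real (real_vec k \<bullet> x)) * u k)"

definition psdo ::
    "(int ^ 'n::finite \<Rightarrow> real ^ 'n \<Rightarrow> complex) \<Rightarrow> (int ^ 'n \<Rightarrow> complex) \<Rightarrow> int ^ 'n \<Rightarrow> complex" where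
  "psdo a u = (\<lambda>k. LINT x:cbox 0 (\<chi> j. 1)|lborel.
     exp (2 * of_real pi * \<i> * of_real (real_vec k \<bullet> x)) * a k x * fourier u x)"

definition formal_adjoint ::
    "(int ^ 'n::finite \<Rightarrow> real ^ 'n \<Rightarrow> complex) \<Rightarrow> (int ^ 'n \<Rightarrow> complex) \<Rightarrow> int ^ 'n \<Rightarrow> complex" where
  "formal_adjoint a v =
     (THE w. w \<in> schwartz \<and> (\<forall>u\<in>schwartz. ell2_inner (psdo a u) v = ell2_inner u w))"

text \<open>
  The extension to tempered distributions:
  \<open>(T\<^sub>a F)(cnj u) = F(cnj (T\<^sub>a\<^sup>\<dagger> u))\<close> for all \<open>u\<close> in the Schwartz space.
\<close>

definition psdo_tempered ::
    "(int ^ 'n::finite \<Rightarrow> real ^ 'n \<Rightarrow> complex) \<Rightarrow> (int ^ 'n \<Rightarrow> complex) \<Rightarrow> int ^ 'n \<Rightarrow> complex" where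
  "psdo_tempered a F =
     (THE G. G \<in> tempered \<and> (\<forall>u\<in>schwartz.
        dual_pairing G (\<lambda>k. cnj (u k)) = dual_pairing F (\<lambda>k. cnj (formal_adjoint a u k))))"

end

theory Submission
  imports Defs
begin

text \<open>
  The operator \<open>T\<^sub>a\<close> is a matrix on the lattice. Expanding \<open>fourier u\<close> and integrating term by term
  gives \<open>(T\<^sub>a u)(k) = \<Sum>\<^sub>l K(k, l) u(l)\<close>, where \<open>K(k, l)\<close> is the Fourier coefficient of \<open>a(k, \<sqdot>)\<close> at
  frequency \<open>l - k\<close>. Integration by parts in \<open>x\<close> turns the symbol estimates into decay away from
  the diagonal: with \<open>w(k) = 1 + |k|\<close>, for every \<open>N\<close>,
  \<open>|K(k, l)| \<le> C w(k)\<^sup>m w(k - l)\<^sup>-\<^sup>N\<close> (\<open>almost_diagonal_symbol_kernel\<close>).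

  The rest is about matrices with this decay. Because \<open>w(l) \<le> w(k - l) w(k)\<close>, polynomial growth
  of a sequence is absorbed by the off-diagonal decay. Hence such a matrix acts on all sequences of
  polynomial growth, the double sums involved converge absolutely, and Fubini identifies the
  conjugate transpose with the formal adjoint and the matrix itself with the extension of \<open>T\<^sub>a\<close> to
  tempered distributions (\<open>matrix_op_adjoint\<close>, \<open>psdo_tempered_eq\<close>).

  For the norm bound, a function \<open>\<phi>\<close> in \<open>RO\<close> changes at most polynomially in the ratio of its
  arguments (\<open>RO_polynomial_growth\<close>), and \<open>\<langle>k\<rangle> / \<langle>l\<rangle>\<close> is at most \<open>2 w(k - l)\<close>. The weighted matrix
  \<open>\<langle>k\<rangle>\<^sup>-\<^sup>m \<phi>(\<langle>k\<rangle>) |K(k, l)| / \<phi>(\<langle>l\<rangle>)\<close> is therefore dominated by \<open>g(k - l)\<close> with \<open>g\<close> summable, and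
  Young's inequality for the convolution of \<open>g\<close> with a square summable sequence yields boundedness
  (\<open>young_ell1_ell2\<close>, \<open>almost_diagonal_bounded\<close>).
\<close>


section \<open>A submultiplicative weight on the lattice\<close>


text \<open>
  This weight is comparable to \<open>japanese\<close> but satisfies the Peetre-type inequality
  \<open>weight (k + l) \<le> weight k * weight l\<close> with constant 1, so that powers of it can be moved
  between \<open>k\<close>, \<open>l\<close> and \<open>k - l\<close> without constants depending on the exponent.
\<close>
definition weight :: "int ^ 'n::finite \<Rightarrow> real" where
  "weight k = 1 + lnorm k"

lemma weight_ge_1 [simp]: "1 \<le> weight k"
  by (simp add: weight_def lnorm_def)

lemma weight_pos [simp]: "0 < weight k"
  using weight_ge_1[of k] by linarith

lemma weight_nonneg [simp]: "0 \<le> weight k"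
  using weight_ge_1[of k] by linarith

lemma weight_nonzero [simp]: "weight k \<noteq> 0"
  using weight_pos[of k] by linarith

lemma weight_uminus [simp]: "weight (- k) = weight k"
proof -
  have "real_vec (- k) = - real_vec k"
    by (simp add: real_vec_def vec_eq_iff)
  then show ?thesis
    by (simp add: weight_def lnorm_def)
qed

lemma weight_diff_commute: "weight (k - l) = weight (l - k)"
  using weight_uminus[of "k - l"] by simp

lemma weight_add_le: "weight (k + l) \<le> weight k * weight l"
proof -
  have "real_vec (k + l) = real_vec k + real_vec l"
    by (simp add: real_vec_def vec_eq_iff)
  then have "lnorm (k + l) \<le> lnorm k + lnorm l"
    by (simp add: lnorm_def norm_triangle_ineq)
  moreover have "0 \<le> lnorm k * lnorm l"
    by (simp add: lnorm_def)
  ultimately show ?thesis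
    by (simp add: weight_def algebra_simps)
qed

lemma weight_le_diff: "weight k \<le> weight (k - l) * weight l"
  using weight_add_le[of "k - l" l] by simp

lemma weight_le_diff': "weight l \<le> weight (k - l) * weight k"
  using weight_le_diff[of l k] by (simp add: weight_diff_commute)

lemma component_le_weight: "1 + \<bar>real_of_int (k $ j)\<bar> \<le> weight k"
  using component_le_norm_cart[of "real_vec k" j]
  by (simp add: weight_def lnorm_def real_vec_def)

lemma abs_component_le_weight: "\<bar>real_of_int (k $ j)\<bar> \<le> weight k"
  using component_le_weight[of k j] by linarith

text \<open>
  Reduces decay in \<open>weight k\<close> to decay in each coordinate separately: the norm of \<open>k\<close> is at most the
  number of coordinates times the largest of them. It serves both for the Schwartz seminorms and
  for Fourier coefficients, where only one variable at a time is integrated by parts.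
\<close>
lemma weight_power_le:
  fixes k :: "int ^ 'n::finite"
  shows "weight k ^ N
    \<le> (1 + real CARD('n)) ^ N * (1 + (\<Sum>j\<in>UNIV. \<bar>real_of_int (k $ j)\<bar> ^ N))"
proof -
  define M where "M = Max (insert 1 (range (\<lambda>j. \<bar>real_of_int (k $ j)\<bar>)))"
  have M1: "1 \<le> M" and Mj: "\<And>j. \<bar>real_of_int (k $ j)\<bar> \<le> M"
    unfolding M_def by (intro Max_ge; simp)+
  have "lnorm k \<le> (\<Sum>j\<in>UNIV. \<bar>real_of_int (k $ j)\<bar>)"
    using norm_le_l1_cart[of "real_vec k"] by (simp add: lnorm_def real_vec_def)
  also have "\<dots> \<le> real CARD('n) * M"
    using sum_bounded_above[of UNIV "\<lambda>j. \<bar>real_of_int (k $ j)\<bar>" M] Mj by simp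
  finally have "weight k \<le> (1 + real CARD('n)) * M"
    using M1 by (simp add: weight_def algebra_simps)
  then have "weight k ^ N \<le> (1 + real CARD('n)) ^ N * M ^ N"
    unfolding power_mult_distrib[symmetric] by (intro power_mono) auto
  also have "M ^ N \<le> 1 + (\<Sum>j\<in>UNIV. \<bar>real_of_int (k $ j)\<bar> ^ N)"
  proof -
    have "M \<in> insert 1 (range (\<lambda>j. \<bar>real_of_int (k $ j)\<bar>))"
      unfolding M_def by (intro Max_in) auto
    then consider "M = 1" | j where "M = \<bar>real_of_int (k $ j)\<bar>"
      by auto
    then show ?thesis
    proof cases
      case 1
      then show ?thesis by (simp add: sum_nonneg)
    next
      case (2 j)
      have "\<bar>real_of_int (k $ j)\<bar> ^ N \<le> (\<Sum>j\<in>UNIV. \<bar>real_of_int (k $ j)\<bar> ^ N)"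
        by (intro member_le_sum) auto
      then show ?thesis using 2 by simp
    qed
  qed
  finally show ?thesis
    by (simp add: mult_left_mono)
qed

lemma japanese_ge_1 [simp]: "1 \<le> japanese k"
  by (simp add: japanese_def)

lemma japanese_le_weight: "japanese k \<le> weight k"
  unfolding japanese_def weight_def
  by (rule real_le_lsqrt) (auto simp: lnorm_def power2_eq_square algebra_simps)

lemma weight_le_japanese: "weight k \<le> 2 * japanese k"
proof -
  have "lnorm k \<le> japanese k"
    unfolding japanese_def by (rule real_le_rsqrt) simp
  then show ?thesis
    using japanese_ge_1[of k] by (simp add: weight_def del: japanese_ge_1)
qed

lemma japanese_peetre: "japanese k \<le> 2 * weight (k - l) * japanese l"
proof -
  have "japanese k \<le> weight (k - l) * weight l"
    using japanese_le_weight weight_le_diff order_trans by blast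
  also have "\<dots> \<le> weight (k - l) * (2 * japanese l)"
    by (intro mult_left_mono weight_le_japanese) simp
  finally show ?thesis by simp
qed

lemma summable_on_int_inverse_square:
  "(\<lambda>i::int. 1 / (1 + \<bar>real_of_int i\<bar>)\<^sup>2) summable_on UNIV"
proof -
  have s: "(\<lambda>n::nat. 1 / (1 + real n)\<^sup>2) summable_on UNIV"
  proof (rule norm_summable_imp_summable_on)
    have "summable (\<lambda>n::nat. inverse (real (Suc n) ^ 2))"
      by (subst summable_Suc_iff) (rule inverse_power_summable, simp)
    then show "summable (\<lambda>n::nat. norm (1 / (1 + real n)\<^sup>2))"
      by (simp add: inverse_eq_divide)
  qed
  have 1: "(\<lambda>i::int. 1 / (1 + \<bar>real_of_int i\<bar>)\<^sup>2) summable_on range int"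
    by (subst summable_on_reindex) (auto simp: o_def intro: s)
  have 2: "(\<lambda>i::int. 1 / (1 + \<bar>real_of_int i\<bar>)\<^sup>2) summable_on range (\<lambda>n. - int n)"
    by (subst summable_on_reindex) (auto simp: o_def inj_on_def intro: s)
  have "(UNIV :: int set) = range int \<union> range (\<lambda>n. - int n)"
    by (auto simp: image_iff) (metis nat_le_iff_add int_cases2)
  then show ?thesis
    using summable_on_union[OF 1 2] by simp
qed

text \<open>
  Since every factor \<open>1 + |k\<^sub>j|\<close> is at most \<open>weight k\<close>, the summand is bounded by the product over the
  coordinates of \<open>(1 + |k\<^sub>j|)\<^sup>-\<^sup>2\<close>, and sums of such products over boxes factorise.
\<close>
lemma summable_on_weight:
  "(\<lambda>k::int ^ 'n::finite. 1 / weight k ^ (2 * CARD('n))) summable_on UNIV"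
proof (rule nonneg_bdd_above_summable_on)
  let ?g = "\<lambda>i::int. 1 / (1 + \<bar>real_of_int i\<bar>)\<^sup>2"
  show "bdd_above (sum (\<lambda>k::int ^ 'n. 1 / weight k ^ (2 * CARD('n))) ` {F. F \<subseteq> UNIV \<and> finite F})"
  proof (rule bdd_aboveI2)
    fix F :: "(int ^ 'n) set"
    assume "F \<in> {F. F \<subseteq> UNIV \<and> finite F}"
    then have F: "finite F" by simp
    \<comment> \<open>\<open>F\<close> lies in the box of all vectors with entries in \<open>B\<close>.\<close>
    define B where "B = (\<Union>j. (\<lambda>k. k $ j) ` F)"
    have B: "finite B" unfolding B_def using F by auto
    have le: "1 / weight k ^ (2 * CARD('n)) \<le> (\<Prod>j\<in>UNIV. ?g (k $ j))" for k :: "int ^ 'n"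
    proof -
      have "(\<Prod>j\<in>(UNIV::'n set). (1 + \<bar>real_of_int (k $ j)\<bar>)\<^sup>2) \<le> (\<Prod>j\<in>(UNIV::'n set). (weight k)\<^sup>2)"
        by (intro prod_mono conjI power_mono component_le_weight) auto
      also have "\<dots> = weight k ^ (2 * CARD('n))"
        by (simp add: power_mult)
      finally have "1 / weight k ^ (2 * CARD('n)) \<le> 1 / (\<Prod>j\<in>(UNIV::'n set). (1 + \<bar>real_of_int (k $ j)\<bar>)\<^sup>2)"
        by (intro divide_left_mono mult_pos_pos zero_less_power prod_pos) auto
      then show ?thesis
        by (simp add: prod_dividef)
    qed
    have "(\<Sum>k\<in>F. 1 / weight k ^ (2 * CARD('n))) \<le> (\<Sum>k\<in>F. \<Prod>j\<in>UNIV. ?g (k $ j))"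
      by (intro sum_mono le)
    also have "\<dots> = (\<Sum>f\<in>vec_nth ` F. \<Prod>j\<in>UNIV. ?g (f j))"
      by (subst sum.reindex) (auto simp: inj_on_def vec_nth_inject)
    also have "\<dots> \<le> (\<Sum>f\<in>PiE (UNIV :: 'n set) (\<lambda>_. B). \<Prod>j\<in>UNIV. ?g (f j))"
      using F by (intro sum_mono2 finite_PiE prod_nonneg ballI) (auto simp: B B_def)
    also have "\<dots> = (\<Prod>j\<in>(UNIV::'n set). \<Sum>i\<in>B. ?g i)"
      using B by (intro prod_sum_PiE[symmetric]) auto
    also have "\<dots> \<le> (\<Prod>j\<in>(UNIV::'n set). infsum ?g UNIV)"
      by (intro prod_mono conjI sum_nonneg finite_sum_le_infsum summable_on_int_inverse_square B) auto
    finally show "(\<Sum>k\<in>F. 1 / weight k ^ (2 * CARD('n))) \<le> (\<Prod>j\<in>(UNIV::'n set). infsum ?g UNIV)" .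
  qed
qed auto

section \<open>Schwartz sequences\<close>
definition rapidly_decreasing :: "(int ^ 'n::finite \<Rightarrow> complex) \<Rightarrow> bool" where
  "rapidly_decreasing u \<longleftrightarrow> (\<forall>N. \<exists>C. \<forall>k. weight k ^ N * cmod (u k) \<le> C)"

lemma distinct_coords: "distinct (coords :: 'n::finite list)"
  and set_coords: "set (coords :: 'n::finite list) = UNIV"
proof -
  have "\<exists>js :: 'n list. distinct js \<and> set js = UNIV"
    using finite_distinct_list[of "UNIV :: 'n set"] by auto
  then have "distinct (coords :: 'n list) \<and> set (coords :: 'n list) = UNIV"
    unfolding coords_def by (rule someI_ex)
  then show "distinct (coords :: 'n list)" "set (coords :: 'n list) = UNIV"
    by auto
qed

lemma multi_diff_0: "multi_diff (0 :: nat ^ 'n::finite) u = u"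
proof -
  have "foldr (\<lambda>j. lattice_diff j ^^ ((0 :: nat ^ 'n) $ j)) js u = u" for js
    by (induction js) auto
  then show ?thesis by (simp add: multi_diff_def)
qed

lemma rapidly_decreasing_lattice_diff:
  assumes "rapidly_decreasing u"
  shows "rapidly_decreasing (lattice_diff j u)"
  unfolding rapidly_decreasing_def
proof
  fix N
  obtain C where C: "\<And>k. weight k ^ N * cmod (u k) \<le> C"
    using assms unfolding rapidly_decreasing_def by meson
  define b where "b = weight (axis j 1 :: int ^ 'a)"
  have "weight k ^ N * cmod (lattice_diff j u k) \<le> b ^ N * C + C" for k
  proof -
    have "weight k ^ N \<le> (b * weight (k + axis j 1)) ^ N"
      using weight_le_diff'[of k "k + axis j 1"] by (intro power_mono) (auto simp: b_def)
    then have "weight k ^ N * cmod (u (k + axis j 1))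
        \<le> (b * weight (k + axis j 1)) ^ N * cmod (u (k + axis j 1))"
      by (rule mult_right_mono) simp
    also have "\<dots> = b ^ N * (weight (k + axis j 1) ^ N * cmod (u (k + axis j 1)))"
      by (simp add: power_mult_distrib)
    also have "\<dots> \<le> b ^ N * C"
      by (intro mult_left_mono C) (simp add: b_def)
    finally have 1: "weight k ^ N * cmod (u (k + axis j 1)) \<le> b ^ N * C" .
    have "weight k ^ N * cmod (lattice_diff j u k)
        \<le> weight k ^ N * (cmod (u (k + axis j 1)) + cmod (u k))"
      unfolding lattice_diff_def by (intro mult_left_mono norm_triangle_ineq4) simp
    then show ?thesis
      using 1 C[of k] by (simp add: distrib_left)
  qed
  then show "\<exists>C. \<forall>k. weight k ^ N * cmod (lattice_diff j u k) \<le> C"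
    by blast
qed

lemma rapidly_decreasing_multi_diff:
  assumes "rapidly_decreasing u"
  shows "rapidly_decreasing (multi_diff \<beta> u)"
proof -
  have 1: "rapidly_decreasing ((lattice_diff j ^^ l) v)" if "rapidly_decreasing v" for j l v
    using that by (induction l) (auto intro: rapidly_decreasing_lattice_diff)
  have "rapidly_decreasing (foldr (\<lambda>j. lattice_diff j ^^ (\<beta> $ j)) js u)" for js
    by (induction js) (auto intro: 1 assms)
  then show ?thesis
    by (simp add: multi_diff_def)
qed

text \<open>
  A shift by a unit vector changes \<open>weight\<close> by a bounded factor only, so rapid decrease is inherited
  by all differences; the converse uses the monomials in a single coordinate.
\<close>
lemma schwartz_iff_rapidly_decreasing:
  fixes u :: "int ^ 'n::finite \<Rightarrow> complex"
  shows "u \<in> schwartz \<longleftrightarrow> rapidly_decreasing u"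
proof
  assume u: "u \<in> schwartz"
  have bdd: "\<exists>C. \<forall>k. (\<Prod>j\<in>UNIV. \<bar>real_of_int (k $ j)\<bar> ^ (\<alpha> $ j)) * cmod (u k) \<le> C" for \<alpha>
  proof -
    have "bdd_above (range (\<lambda>k. cmod (of_int (\<Prod>j\<in>UNIV. (k $ j) ^ (\<alpha> $ j)) * multi_diff 0 u k)))"
      using u[unfolded schwartz_def mem_Collect_eq, rule_format, of \<alpha> 0] .
    then obtain C where "\<And>k. cmod (of_int (\<Prod>j\<in>UNIV. (k $ j) ^ (\<alpha> $ j)) * multi_diff 0 u k) \<le> C"
      unfolding bdd_above_def by auto
    then show ?thesis
      by (intro exI[of _ C]) (simp add: multi_diff_0 norm_mult norm_power flip: prod_norm)
  qed
  show "rapidly_decreasing u"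
    unfolding rapidly_decreasing_def
  proof
    fix N
    obtain C0 where C0: "\<And>k. cmod (u k) \<le> C0"
      using bdd[of 0] by auto
    have ax: "(\<Prod>i\<in>UNIV. \<bar>real_of_int (k $ i)\<bar> ^ (axis j N $ i)) = \<bar>real_of_int (k $ j)\<bar> ^ N"
      for j and k :: "int ^ 'n"
    proof -
      have "(\<Prod>i\<in>UNIV. \<bar>real_of_int (k $ i)\<bar> ^ (axis j N $ i))
          = (\<Prod>i\<in>UNIV. if i = j then \<bar>real_of_int (k $ j)\<bar> ^ N else 1)"
        by (intro prod.cong) (auto simp: axis_def)
      then show ?thesis by simp
    qed
    have "\<forall>j. \<exists>C. \<forall>k. \<bar>real_of_int (k $ j)\<bar> ^ N * cmod (u k) \<le> C"
      using bdd[of "axis j N" for j] by (simp add: ax)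
    then obtain C where C: "\<And>j k. \<bar>real_of_int (k $ j)\<bar> ^ N * cmod (u k) \<le> C j"
      by metis
    have "weight k ^ N * cmod (u k) \<le> (1 + real CARD('n)) ^ N * (C0 + (\<Sum>j\<in>UNIV. C j))" for k
    proof -
      have "weight k ^ N * cmod (u k) \<le>
        ((1 + real CARD('n)) ^ N * (1 + (\<Sum>j\<in>UNIV. \<bar>real_of_int (k $ j)\<bar> ^ N))) * cmod (u k)"
        by (intro mult_right_mono weight_power_le) simp
      also have "\<dots> = (1 + real CARD('n)) ^ N *
          (cmod (u k) + (\<Sum>j\<in>UNIV. \<bar>real_of_int (k $ j)\<bar> ^ N * cmod (u k)))"
        by (simp add: algebra_simps sum_distrib_left sum_distrib_right)
      also have "\<dots> \<le> (1 + real CARD('n)) ^ N * (C0 + (\<Sum>j\<in>UNIV. C j))"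
        by (intro mult_left_mono add_mono sum_mono C C0) simp
      finally show ?thesis .
    qed
    then show "\<exists>C. \<forall>k. weight k ^ N * cmod (u k) \<le> C"
      by blast
  qed
next
  assume u: "rapidly_decreasing u"
  show "u \<in> schwartz"
    unfolding schwartz_def
  proof (intro CollectI allI)
    fix \<alpha> \<beta> :: "nat ^ 'n"
    define N where "N = (\<Sum>j\<in>UNIV. \<alpha> $ j)"
    obtain C where C: "\<And>k. weight k ^ N * cmod (multi_diff \<beta> u k) \<le> C"
      using rapidly_decreasing_multi_diff[OF u] unfolding rapidly_decreasing_def by meson
    have "cmod (of_int (\<Prod>j\<in>UNIV. (k $ j) ^ (\<alpha> $ j)) * multi_diff \<beta> u k) \<le> C" for k
    proof -
      have "(\<Prod>j\<in>UNIV. \<bar>real_of_int (k $ j)\<bar> ^ (\<alpha> $ j)) \<le> (\<Prod>j\<in>UNIV. weight k ^ (\<alpha> $ j))"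
        by (intro prod_mono conjI power_mono abs_component_le_weight) auto
      also have "\<dots> = weight k ^ N"
        by (simp add: N_def power_sum)
      finally have "(\<Prod>j\<in>UNIV. \<bar>real_of_int (k $ j)\<bar> ^ (\<alpha> $ j)) * cmod (multi_diff \<beta> u k)
          \<le> weight k ^ N * cmod (multi_diff \<beta> u k)"
        by (rule mult_right_mono) simp
      then show ?thesis
        using C[of k] by (simp add: norm_mult norm_power flip: prod_norm)
    qed
    then show "bdd_above (range (\<lambda>k. cmod (of_int (\<Prod>j\<in>UNIV. (k $ j) ^ (\<alpha> $ j)) * multi_diff \<beta> u k)))"
      by (intro bdd_aboveI2)
  qed
qed

section \<open>Growth of RO-varying functions\<close>

text \<open>
  A factor \<open>s \<le> a\<^sup>n\<close> is reached in \<open>n\<close> steps of size at most \<open>a\<close>, each costing a factor \<open>c\<close>. If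
  \<open>p\<close> is chosen with \<open>c \<le> a\<^sup>p\<close>, then each full step costs at most \<open>a\<^sup>p\<close>, so that altogether the cost
  is at most \<open>c s\<^sup>p\<close>. The two-sided hypothesis on \<open>x\<close> and \<open>y\<close> makes the bound symmetric, as needed
  for the ratio \<open>\<langle>k\<rangle> / \<langle>l\<rangle>\<close>, which may be large or small.
\<close>
lemma RO_polynomial_growth:
  assumes "\<phi> \<in> RO"
  obtains c p where "1 \<le> c"
    and "\<And>x y r. 1 \<le> x \<Longrightarrow> 1 \<le> y \<Longrightarrow> x \<le> r * y \<Longrightarrow> y \<le> r * x \<Longrightarrow> \<phi> x \<le> c * r ^ p * \<phi> y"
proof -
  obtain a c where a: "1 < a" and c: "1 \<le> c"
    and ratio: "\<And>t s. 1 \<le> t \<Longrightarrow> s \<in> {1..a} \<Longrightarrow>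
      inverse c \<le> \<phi> (s * t) / \<phi> t \<and> \<phi> (s * t) / \<phi> t \<le> c"
    using assms unfolding RO_def by blast
  have pos: "0 < \<phi> t" if "1 \<le> t" for t
    using assms that unfolding RO_def by blast
  obtain p where p: "c < a ^ p"
    using real_arch_pow[OF a] by blast
  have one_step: "\<phi> (s * t) \<le> c * \<phi> t \<and> \<phi> t \<le> c * \<phi> (s * t)"
    if "1 \<le> t" "1 \<le> s" "s \<le> a" for s t
    using ratio[of t s] that pos[of t] c by (auto simp: field_simps)
  have steps: "\<phi> (s * t) \<le> c * s ^ p * \<phi> t \<and> \<phi> t \<le> c * s ^ p * \<phi> (s * t)"
    if "1 \<le> t" "1 \<le> s" "s \<le> a ^ n" for n s t
    using that
  proof (induction n arbitrary: s t)
    case 0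
    then have "s = 1" by simp
    then show ?case
      using c pos[OF \<open>1 \<le> t\<close>] by simp
  next
    case (Suc n)
    have st: "1 \<le> s * t"
      using mult_mono[of 1 s 1 t] Suc.prems by simp
    show ?case
    proof (cases "s \<le> a")
      case True
      have sp: "1 \<le> s ^ p"
        using Suc.prems by simp
      have "c * \<phi> t \<le> c * s ^ p * \<phi> t" "c * \<phi> (s * t) \<le> c * s ^ p * \<phi> (s * t)"
        using sp c pos[OF \<open>1 \<le> t\<close>] pos[OF st] by (auto intro!: mult_right_mono)
      then show ?thesis
        using one_step[of t s] True Suc.prems by linarith
    next
      case False
      define s' where "s' = s / a"
      have s': "1 \<le> s'" "s' \<le> a ^ n" "s = s' * a"
        using False a Suc.prems by (auto simp: s'_def field_simps)
      have at: "1 \<le> a * t"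
        using mult_mono[of 1 a 1 t] Suc.prems a by simp
      have IH: "\<phi> (s * t) \<le> c * s' ^ p * \<phi> (a * t)" "\<phi> (a * t) \<le> c * s' ^ p * \<phi> (s * t)"
        using Suc.IH[OF at s'(1,2)] s'(3) by (auto simp: mult.assoc)
      have step: "\<phi> (a * t) \<le> c * \<phi> t" "\<phi> t \<le> c * \<phi> (a * t)"
        using one_step[of t a] Suc.prems a by auto
      have s'p: "0 \<le> s' ^ p" "c * s' ^ p \<le> s ^ p"
        using s'(1) p by (auto simp: s'(3) power_mult_distrib mult.commute intro!: mult_right_mono)
      have "\<phi> (s * t) \<le> c * s' ^ p * (c * \<phi> t)"
        using IH(1) step(1) s'p c by (meson mult_left_mono mult_nonneg_nonneg order_trans zero_le_one)
      also have "\<dots> = c * \<phi> t * (c * s' ^ p)"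
        by (simp add: algebra_simps)
      also have "\<dots> \<le> c * \<phi> t * s ^ p"
        using s'p(2) c pos[OF \<open>1 \<le> t\<close>] by (intro mult_left_mono) auto
      finally have 1: "\<phi> (s * t) \<le> c * s ^ p * \<phi> t"
        by (simp add: algebra_simps)
      have "\<phi> t \<le> c * (c * s' ^ p * \<phi> (s * t))"
        using IH(2) step(2) c by (meson mult_left_mono order_trans zero_le_one)
      also have "\<dots> = c * \<phi> (s * t) * (c * s' ^ p)"
        by (simp add: algebra_simps)
      also have "\<dots> \<le> c * \<phi> (s * t) * s ^ p"
        using s'p(2) c pos[OF st] by (intro mult_left_mono) auto
      finally have 2: "\<phi> t \<le> c * s ^ p * \<phi> (s * t)"
        by (simp add: algebra_simps)
      show ?thesis
        using 1 2 by blast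
    qed
  qed
  have steps': "\<phi> (s * t) \<le> c * s ^ p * \<phi> t \<and> \<phi> t \<le> c * s ^ p * \<phi> (s * t)"
    if "1 \<le> t" "1 \<le> s" for s t
    using steps[OF that] real_arch_pow[OF a, of s] by (meson less_imp_le)
  have "\<phi> x \<le> c * r ^ p * \<phi> y" if xy: "1 \<le> x" "1 \<le> y" "x \<le> r * y" "y \<le> r * x" for x y r
  proof -
    have "\<exists>s. 1 \<le> s \<and> s \<le> r \<and> \<phi> x \<le> c * s ^ p * \<phi> y"
    proof (cases "y \<le> x")
      case True
      then show ?thesis
        using steps'[of y "x / y"] xy by (intro exI[of _ "x / y"]) (auto simp: field_simps)
    next
      case False
      then show ?thesis
        using steps'[of x "y / x"] xy by (intro exI[of _ "y / x"]) (auto simp: field_simps)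
    qed
    then obtain s where s: "1 \<le> s" "s \<le> r" "\<phi> x \<le> c * s ^ p * \<phi> y"
      by blast
    have "s ^ p \<le> r ^ p"
      using s by (intro power_mono) auto
    then have "c * s ^ p * \<phi> y \<le> c * r ^ p * \<phi> y"
      using c pos[OF xy(2)] by (intro mult_right_mono mult_left_mono) auto
    with s show ?thesis by simp
  qed
  with c show ?thesis
    by (rule that)
qed

lemma RO_pos: "\<phi> \<in> RO \<Longrightarrow> 1 \<le> t \<Longrightarrow> 0 < \<phi> t"
  by (simp add: RO_def)

section \<open>Young's inequality on the lattice\<close>
lemma summable_on_dominated:
  fixes f :: "'a \<Rightarrow> 'b::banach"
  assumes "g summable_on A" "\<And>x. x \<in> A \<Longrightarrow> norm (f x) \<le> g x"
  shows "f summable_on A" "f abs_summable_on A" "norm (infsum f A) \<le> infsum g A"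
proof -
  show *: "f abs_summable_on A"
    by (rule Infinite_Sum.abs_summable_on_comparison_test'[OF assms])
  then show "f summable_on A"
    by (rule abs_summable_summable)
  have "norm (infsum f A) \<le> infsum (\<lambda>x. norm (f x)) A"
    by (rule norm_infsum_bound[OF *])
  also have "\<dots> \<le> infsum g A"
    by (rule infsum_mono[OF * assms])
  finally show "norm (infsum f A) \<le> infsum g A" .
qed

lemma
  fixes g :: "int ^ 'n::finite \<Rightarrow> real"
  shows summable_on_translate: "(\<lambda>l. g (k - l)) summable_on UNIV \<longleftrightarrow> g summable_on UNIV"
    and infsum_translate: "(\<Sum>\<^sub>\<infinity>l. g (k - l)) = infsum g UNIV"
    and summable_on_translate': "(\<lambda>l. g (l - k)) summable_on UNIV \<longleftrightarrow> g summable_on UNIV"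
    and infsum_translate': "(\<Sum>\<^sub>\<infinity>l. g (l - k)) = infsum g UNIV"
proof -
  have 1: "bij_betw (\<lambda>l. k - l) UNIV UNIV"
    by (rule bij_betwI[of _ _ _ "\<lambda>l. k - l"]) auto
  have 2: "bij_betw (\<lambda>l. l - k) UNIV UNIV"
    by (rule bij_betwI[of _ _ _ "\<lambda>l. l + k"]) auto
  show "(\<lambda>l. g (k - l)) summable_on UNIV \<longleftrightarrow> g summable_on UNIV"
    "(\<Sum>\<^sub>\<infinity>l. g (k - l)) = infsum g UNIV"
    "(\<lambda>l. g (l - k)) summable_on UNIV \<longleftrightarrow> g summable_on UNIV"
    "(\<Sum>\<^sub>\<infinity>l. g (l - k)) = infsum g UNIV"
    by (rule summable_on_reindex_bij_betw[OF 1] infsum_reindex_bij_betw[OF 1]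
        summable_on_reindex_bij_betw[OF 2] infsum_reindex_bij_betw[OF 2])+
qed

text \<open>
  By the Cauchy-Schwarz inequality with respect to the weights \<open>g (k - l)\<close>,
  \<open>(g * U)(k)\<^sup>2 \<le> \<parallel>g\<parallel>\<^sub>1 (g * U\<^sup>2)(k)\<close>; summing over \<open>k\<close> and exchanging the sums gives another
  factor \<open>\<parallel>g\<parallel>\<^sub>1\<close>.
\<close>
lemma young_ell1_ell2:
  fixes g U :: "int ^ 'n::finite \<Rightarrow> real"
  assumes g: "g summable_on UNIV" "\<And>q. 0 \<le> g q"
    and U: "(\<lambda>l. (U l)\<^sup>2) summable_on UNIV" "\<And>l. 0 \<le> U l"
  shows "(\<lambda>l. g (k - l) * U l) summable_on UNIV" (is ?th1)
    and "(\<lambda>k. (\<Sum>\<^sub>\<infinity>l. g (k - l) * U l)\<^sup>2) summable_on UNIV" (is ?th2)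
    and "(\<Sum>\<^sub>\<infinity>k. (\<Sum>\<^sub>\<infinity>l. g (k - l) * U l)\<^sup>2) \<le> (infsum g UNIV)\<^sup>2 * (\<Sum>\<^sub>\<infinity>l. (U l)\<^sup>2)" (is ?th3)
proof -
  define G where "G = infsum g UNIV"
  define S where "S = (\<Sum>\<^sub>\<infinity>l. (U l)\<^sup>2)"
  have US: "(U l)\<^sup>2 \<le> S" for l
    using finite_sum_le_infsum[OF U(1), of "{l}"] by (simp add: S_def)
  have U1S: "U l \<le> 1 + S" for l
  proof -
    have "0 \<le> (U l - 1)\<^sup>2" by simp
    then have "2 * U l \<le> 1 + (U l)\<^sup>2"
      by (simp add: power2_eq_square algebra_simps)
    then show ?thesis using US[of l] U(2)[of l] by linarith
  qed
  have gk: "(\<lambda>l. c * g (k - l)) summable_on UNIV" for c k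
    using g(1) by (intro summable_on_cmult_right) (simp add: summable_on_translate)
  have gU: "(\<lambda>l. g (k - l) * U l) summable_on UNIV" for k
    by (rule summable_on_dominated(1)[OF gk[of "1 + S" k]])
      (use g(2) U(2) U1S in \<open>auto simp: abs_mult mult.commute intro!: mult_right_mono\<close>)
  have gU2: "(\<lambda>l. g (k - l) * (U l)\<^sup>2) summable_on UNIV" for k
    by (rule summable_on_dominated(1)[OF gk[of "S" k]])
      (use g(2) US in \<open>auto simp: abs_mult mult.commute[of S] intro!: mult_left_mono\<close>)
  have G0: "0 \<le> G"
    unfolding G_def by (rule infsum_nonneg) (rule g(2))
  have CS: "(\<Sum>\<^sub>\<infinity>l. g (k - l) * U l)\<^sup>2 \<le> G * (\<Sum>\<^sub>\<infinity>l. g (k - l) * (U l)\<^sup>2)" for k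
  proof -
    let ?T = "\<Sum>\<^sub>\<infinity>l. g (k - l) * (U l)\<^sup>2"
    have T0: "0 \<le> ?T"
      by (rule infsum_nonneg) (use g(2) in auto)
    have "(\<Sum>\<^sub>\<infinity>l. g (k - l) * U l) \<le> sqrt (G * ?T)"
    proof (rule infsum_le_finite_sums[OF gU])
      fix F :: "(int ^ 'n) set"
      assume F: "finite F"
      have "(\<Sum>l\<in>F. g (k - l) * U l)\<^sup>2
          = (\<Sum>l\<in>F. sqrt (g (k - l)) * (sqrt (g (k - l)) * U l))\<^sup>2"
        using g(2) by (simp flip: mult.assoc)
      also have "\<dots> \<le> (\<Sum>l\<in>F. (sqrt (g (k - l)))\<^sup>2) * (\<Sum>l\<in>F. (sqrt (g (k - l)) * U l)\<^sup>2)"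
        by (rule Cauchy_Schwarz_ineq_sum)
      also have "\<dots> = (\<Sum>l\<in>F. g (k - l)) * (\<Sum>l\<in>F. g (k - l) * (U l)\<^sup>2)"
        using g(2) by (simp add: power_mult_distrib)
      also have "\<dots> \<le> G * ?T"
      proof (rule mult_mono)
        show "(\<Sum>l\<in>F. g (k - l)) \<le> G"
          unfolding G_def infsum_translate[of g k, symmetric]
          using g F gk[of 1 k] by (intro finite_sum_le_infsum) auto
        show "(\<Sum>l\<in>F. g (k - l) * (U l)\<^sup>2) \<le> ?T"
          using g F gU2[of k] by (intro finite_sum_le_infsum) auto
      qed (use G0 g(2) in \<open>auto intro!: sum_nonneg\<close>)
      finally show "(\<Sum>l\<in>F. g (k - l) * U l) \<le> sqrt (G * ?T)"
        by (rule real_le_rsqrt)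
    qed
    moreover have "0 \<le> (\<Sum>\<^sub>\<infinity>l. g (k - l) * U l)"
      by (rule infsum_nonneg) (use g(2) U(2) in auto)
    ultimately have "(\<Sum>\<^sub>\<infinity>l. g (k - l) * U l)\<^sup>2 \<le> (sqrt (G * ?T))\<^sup>2"
      by (intro power_mono) auto
    then show ?thesis
      using G0 T0 by simp
  qed
  \<comment> \<open>The double sum is summed first over \<open>k\<close>, where translation invariance gives the value
    \<open>G * (U l)\<^sup>2\<close>.\<close>
  have col: "((\<lambda>k. g (k - l) * (U l)\<^sup>2) has_sum G * (U l)\<^sup>2) UNIV" for l
    unfolding G_def infsum_translate'[of g l, symmetric]
    using g(1) by (intro has_sum_cmult_left has_sum_infsum) (simp add: summable_on_translate')
  have "(\<lambda>(l, k). g (k - l) * (U l)\<^sup>2) summable_on (UNIV \<times> UNIV)"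
    by (rule summable_on_SigmaI[where g = "\<lambda>l. G * (U l)\<^sup>2"])
      (use col U(1) g(2) in \<open>auto intro: summable_on_cmult_right\<close>)
  then have dbl: "(\<lambda>(k, l). g (k - l) * (U l)\<^sup>2) summable_on (UNIV \<times> UNIV)"
    by (subst (asm) summable_on_swap) (simp add: case_prod_unfold)
  have rows: "(\<lambda>k. \<Sum>\<^sub>\<infinity>l. g (k - l) * (U l)\<^sup>2) summable_on UNIV"
    using summable_on_SigmaD[OF dbl] gU2 by simp
  have swap: "(\<Sum>\<^sub>\<infinity>k. \<Sum>\<^sub>\<infinity>l. g (k - l) * (U l)\<^sup>2) = G * S"
  proof -
    have "(\<Sum>\<^sub>\<infinity>k. \<Sum>\<^sub>\<infinity>l. g (k - l) * (U l)\<^sup>2) = (\<Sum>\<^sub>\<infinity>l. \<Sum>\<^sub>\<infinity>k. g (k - l) * (U l)\<^sup>2)"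
      by (rule infsum_swap_banach[OF dbl])
    also have "\<dots> = (\<Sum>\<^sub>\<infinity>l. G * (U l)\<^sup>2)"
      using infsumI[OF col] by simp
    also have "\<dots> = G * S"
      unfolding S_def by (rule infsum_cmult_right) (use U(1) in auto)
    finally show ?thesis .
  qed
  have Grows: "(\<lambda>k. G * (\<Sum>\<^sub>\<infinity>l. g (k - l) * (U l)\<^sup>2)) summable_on UNIV"
    by (intro summable_on_cmult_right rows)
  show ?th1 by (rule gU)
  show ?th2
    by (rule summable_on_dominated(1)[OF Grows]) (use CS in auto)
  then have "(\<Sum>\<^sub>\<infinity>k. (\<Sum>\<^sub>\<infinity>l. g (k - l) * U l)\<^sup>2) \<le> (\<Sum>\<^sub>\<infinity>k. G * (\<Sum>\<^sub>\<infinity>l. g (k - l) * (U l)\<^sup>2))"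
    by (intro infsum_mono Grows CS)
  also have "\<dots> = G * (G * S)"
    by (subst infsum_cmult_right) (use rows swap in auto)
  finally show ?th3
    by (simp add: G_def S_def power2_eq_square mult.assoc)
qed

section \<open>Almost diagonal matrices on tempered sequences\<close>
definition almost_diagonal :: "real \<Rightarrow> (int ^ 'n::finite \<Rightarrow> int ^ 'n \<Rightarrow> complex) \<Rightarrow> bool" where
  "almost_diagonal m K \<longleftrightarrow>
     (\<forall>N. \<exists>C. \<forall>k l. cmod (K k l) \<le> C * weight k powr m / weight (k - l) ^ N)"

definition matrix_op ::
    "(int ^ 'n::finite \<Rightarrow> int ^ 'n \<Rightarrow> complex) \<Rightarrow> (int ^ 'n \<Rightarrow> complex) \<Rightarrow> int ^ 'n \<Rightarrow> complex" where
  "matrix_op K F k = (\<Sum>\<^sub>\<infinity>l. K k l * F l)"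

lemma temperedE:
  fixes F :: "int ^ 'n::finite \<Rightarrow> complex"
  assumes "F \<in> tempered"
  obtains C N where "0 \<le> C" "\<And>k. cmod (F k) \<le> C * weight k ^ N"
proof -
  obtain C N where CN: "\<And>k. cmod (F k) \<le> C * weight k ^ N"
    using assms unfolding tempered_def weight_def by blast
  have "0 \<le> C * weight (0 :: int ^ 'n) ^ N"
    by (rule order_trans[OF norm_ge_zero CN])
  then have "0 \<le> C"
    using zero_less_power[OF weight_pos, of "0 :: int ^ 'n" N] by (simp add: zero_le_mult_iff)
  then show ?thesis by (rule that[OF _ CN])
qed

lemma temperedI:
  assumes "\<And>k. cmod (F k) \<le> C * weight k ^ N"
  shows "F \<in> tempered"
  using assms unfolding tempered_def weight_def by blast

lemma tempered_lincomb:
  assumes "u \<in> tempered" "v \<in> tempered"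
  shows "(\<lambda>k. c * u k + d * v k) \<in> tempered"
proof -
  obtain A M where A: "0 \<le> A" "\<And>k. cmod (u k) \<le> A * weight k ^ M"
    using temperedE[OF assms(1)] by blast
  obtain B N where B: "0 \<le> B" "\<And>k. cmod (v k) \<le> B * weight k ^ N"
    using temperedE[OF assms(2)] by blast
  show ?thesis
  proof (rule temperedI)
    fix k
    have "cmod (c * u k + d * v k) \<le> cmod c * cmod (u k) + cmod d * cmod (v k)"
      using norm_triangle_ineq[of "c * u k" "d * v k"] by (simp add: norm_mult)
    also have "\<dots> \<le> cmod c * (A * weight k ^ (M + N)) + cmod d * (B * weight k ^ (M + N))"
    proof (intro add_mono mult_left_mono)
      have "A * weight k ^ M \<le> A * weight k ^ (M + N)"
        using A(1) by (intro mult_left_mono power_increasing) auto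
      then show "cmod (u k) \<le> A * weight k ^ (M + N)"
        using A(2)[of k] by linarith
      have "B * weight k ^ N \<le> B * weight k ^ (M + N)"
        using B(1) by (intro mult_left_mono power_increasing) auto
      then show "cmod (v k) \<le> B * weight k ^ (M + N)"
        using B(2)[of k] by linarith
    qed auto
    finally show "cmod (c * u k + d * v k) \<le> (cmod c * A + cmod d * B) * weight k ^ (M + N)"
      by (simp add: algebra_simps)
  qed
qed

lemma schwartz_bound:
  assumes "u \<in> schwartz"
  obtains C where "0 \<le> C" "\<And>k. cmod (u k) \<le> C / weight k ^ N"
proof -
  obtain C where C: "\<And>k. weight k ^ N * cmod (u k) \<le> C"
    using assms unfolding schwartz_iff_rapidly_decreasing rapidly_decreasing_def by meson
  have "0 \<le> C"
    by (rule order_trans[OF _ C[of 0]]) simp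
  moreover have "cmod (u k) \<le> C / weight k ^ N" for k
    using C[of k] by (simp add: field_simps)
  ultimately show ?thesis by (rule that)
qed

lemma schwartz_subset_tempered: "schwartz \<subseteq> tempered"
proof
  fix u :: "int ^ 'a \<Rightarrow> complex"
  assume "u \<in> schwartz"
  then obtain C where "\<And>k. cmod (u k) \<le> C / weight k ^ 0"
    using schwartz_bound[of u 0] by blast
  then show "u \<in> tempered"
    by (intro temperedI[of _ C 0]) simp
qed

definition unit_sequence :: "int ^ 'n::finite \<Rightarrow> int ^ 'n \<Rightarrow> complex" where
  "unit_sequence l k = of_bool (k = l)"

lemma unit_sequence_schwartz: "unit_sequence l \<in> schwartz"
  unfolding schwartz_iff_rapidly_decreasing rapidly_decreasing_def
proof
  fix N
  have "weight k ^ N * cmod (unit_sequence l k) \<le> weight l ^ N" for k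
    by (cases "k = l") (auto simp: unit_sequence_def)
  then show "\<exists>C. \<forall>k. weight k ^ N * cmod (unit_sequence l k) \<le> C"
    by blast
qed

lemma infsum_unit_sequence: "(\<Sum>\<^sub>\<infinity>k. f k * unit_sequence l k) = f l"
proof -
  have "(\<Sum>\<^sub>\<infinity>k. f k * unit_sequence l k) = (\<Sum>\<^sub>\<infinity>k\<in>{l}. f k * unit_sequence l k)"
    by (rule infsum_cong_neutral) (auto simp: unit_sequence_def)
  then show ?thesis by (simp add: unit_sequence_def)
qed

lemma cnj_unit_sequence [simp]: "cnj (unit_sequence l k) = unit_sequence l k"
  by (simp add: unit_sequence_def)

text \<open>
  The growth of \<open>F l\<close> is at most that of \<open>weight (k - l) ^ S * weight k ^ S\<close>, whose first factor is
  absorbed by the off-diagonal decay. The exponent \<open>R\<close> has to be independent of \<open>N\<close>, because later a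
  Schwartz sequence is chosen to beat \<open>weight k ^ R\<close>; a natural number is more convenient there than
  the real order \<open>m\<close>.
\<close>
lemma almost_diagonal_mult_tempered:
  assumes K: "almost_diagonal m K" and F: "F \<in> tempered"
  obtains R where
    "\<And>N. \<exists>C\<ge>0. \<forall>k l. cmod (K k l * F l) \<le> C * weight k ^ R / weight (k - l) ^ N"
proof -
  obtain A S where A: "0 \<le> A" "\<And>l. cmod (F l) \<le> A * weight l ^ S"
    using temperedE[OF F] by blast
  obtain M :: nat where M: "m \<le> real M"
    using real_arch_simple by blast
  have "\<exists>C\<ge>0. \<forall>k l. cmod (K k l * F l) \<le> C * weight k ^ (M + S) / weight (k - l) ^ N" for N
  proof -
    obtain B where B: "\<And>k l. cmod (K k l) \<le> B * weight k powr m / weight (k - l) ^ (N + S)"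
      using K unfolding almost_diagonal_def by meson
    have "cmod (K k l * F l) \<le> \<bar>B\<bar> * A * weight k ^ (M + S) / weight (k - l) ^ N" for k l
    proof -
      have "cmod (K k l) \<le> \<bar>B\<bar> * weight k ^ M / weight (k - l) ^ (N + S)"
      proof -
        have "B * weight k powr m \<le> \<bar>B\<bar> * weight k powr real M"
          using M by (intro mult_mono powr_mono) auto
        then have "B * weight k powr m / weight (k - l) ^ (N + S)
            \<le> \<bar>B\<bar> * weight k powr real M / weight (k - l) ^ (N + S)"
          by (intro divide_right_mono) auto
        then show ?thesis
          using B[of k l] by (simp add: powr_realpow)
      qed
      moreover have "cmod (F l) \<le> A * (weight (k - l) ^ S * weight k ^ S)"
      proof -
        have "weight l ^ S \<le> (weight (k - l) * weight k) ^ S"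
          by (intro power_mono weight_le_diff') simp
        then have "A * weight l ^ S \<le> A * (weight (k - l) ^ S * weight k ^ S)"
          using A(1) by (intro mult_left_mono) (auto simp: power_mult_distrib)
        then show ?thesis using A(2)[of l] by linarith
      qed
      ultimately have "cmod (K k l) * cmod (F l)
          \<le> (\<bar>B\<bar> * weight k ^ M / weight (k - l) ^ (N + S)) * (A * (weight (k - l) ^ S * weight k ^ S))"
        by (intro mult_mono) auto
      also have "\<dots> = \<bar>B\<bar> * A * weight k ^ (M + S) / weight (k - l) ^ N"
        by (simp add: power_add field_simps)
      finally show ?thesis by (simp add: norm_mult)
    qed
    then show ?thesis
      using A(1) by (intro exI[of _ "\<bar>B\<bar> * A"]) auto
  qed
  then show ?thesis by (rule that)
qed



lemma summable_on_weight_translate: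
  fixes k :: "int ^ 'n::finite"
  shows "(\<lambda>l. c / weight (k - l) ^ (2 * CARD('n))) summable_on UNIV"
    and "(\<lambda>l. c / weight (l - k) ^ (2 * CARD('n))) summable_on UNIV"
  using summable_on_cmult_right[OF summable_on_weight[where 'n = 'n], of c]
    summable_on_translate[of "\<lambda>q. c / weight q ^ (2 * CARD('n))" k]
    summable_on_translate'[of "\<lambda>q. c / weight q ^ (2 * CARD('n))" k]
  by simp_all

lemma infsum_weight_translate:
  fixes k :: "int ^ 'n::finite"
  defines "Z \<equiv> \<Sum>\<^sub>\<infinity>q::int ^ 'n. 1 / weight q ^ (2 * CARD('n))"
  shows "(\<Sum>\<^sub>\<infinity>l. c / weight (k - l) ^ (2 * CARD('n))) = c * Z"
    and "(\<Sum>\<^sub>\<infinity>l. c / weight (l - k) ^ (2 * CARD('n))) = c * Z"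
proof -
  have "(\<Sum>\<^sub>\<infinity>q::int ^ 'n. c * (1 / weight q ^ (2 * CARD('n)))) = c * Z"
    unfolding Z_def by (rule infsum_cmult_right) (rule summable_on_weight)
  then show "(\<Sum>\<^sub>\<infinity>l. c / weight (k - l) ^ (2 * CARD('n))) = c * Z"
    "(\<Sum>\<^sub>\<infinity>l. c / weight (l - k) ^ (2 * CARD('n))) = c * Z"
    using infsum_translate[of "\<lambda>q. c / weight q ^ (2 * CARD('n))" k]
      infsum_translate'[of "\<lambda>q. c / weight q ^ (2 * CARD('n))" k]
    by simp_all
qed

lemma matrix_op_summable:
  assumes K: "almost_diagonal m K" and F: "F \<in> tempered"
  shows "(\<lambda>l. K k l * F l) summable_on UNIV"
proof -
  obtain R where R:
    "\<And>N. \<exists>C\<ge>0. \<forall>k l. cmod (K k l * F l) \<le> C * weight k ^ R / weight (k - l) ^ N"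
    using almost_diagonal_mult_tempered[OF K F] by blast
  obtain C where "\<And>k l. cmod (K k l * F l) \<le> C * weight k ^ R / weight (k - l) ^ (2 * CARD('a))"
    using R[of "2 * CARD('a)"] by blast
  then show ?thesis
    by (intro summable_on_dominated(1)[OF summable_on_weight_translate(1)[of "C * weight k ^ R" k]])
qed

lemma matrix_op_tempered:
  fixes K :: "int ^ 'n::finite \<Rightarrow> int ^ 'n \<Rightarrow> complex"
  assumes K: "almost_diagonal m K" and F: "F \<in> tempered"
  shows "matrix_op K F \<in> tempered"
proof -
  obtain R where R:
    "\<And>N. \<exists>C\<ge>0. \<forall>k l. cmod (K k l * F l) \<le> C * weight k ^ R / weight (k - l) ^ N"
    using almost_diagonal_mult_tempered[OF K F] by blast
  obtain C where C: "\<And>k l. cmod (K k l * F l) \<le> C * weight k ^ R / weight (k - l) ^ (2 * CARD('n))"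
    using R[of "2 * CARD('n)"] by blast
  define Z where "Z = (\<Sum>\<^sub>\<infinity>q::int ^ 'n. 1 / weight q ^ (2 * CARD('n)))"
  have "cmod (matrix_op K F k) \<le> C * Z * weight k ^ R" for k
  proof -
    have "cmod (matrix_op K F k) \<le> (\<Sum>\<^sub>\<infinity>l. C * weight k ^ R / weight (k - l) ^ (2 * CARD('n)))"
      unfolding matrix_op_def
      by (intro summable_on_dominated(3)[OF summable_on_weight_translate(1)] C)
    also have "\<dots> = C * weight k ^ R * Z"
      unfolding Z_def by (rule infsum_weight_translate)
    finally show ?thesis by (simp add: mult_ac)
  qed
  then show ?thesis by (rule temperedI)
qed

lemma matrix_op_lincomb:
  assumes K: "almost_diagonal m K" and u: "u \<in> tempered" and v: "v \<in> tempered"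
  shows "matrix_op K (\<lambda>k. c * u k + d * v k) = (\<lambda>k. c * matrix_op K u k + d * matrix_op K v k)"
proof
  fix k
  note su = matrix_op_summable[OF K u, of k] and sv = matrix_op_summable[OF K v, of k]
  have "matrix_op K (\<lambda>k. c * u k + d * v k) k
      = (\<Sum>\<^sub>\<infinity>l. c * (K k l * u l) + d * (K k l * v l))"
    unfolding matrix_op_def by (rule infsum_cong) (simp add: algebra_simps)
  also have "\<dots> = (\<Sum>\<^sub>\<infinity>l. c * (K k l * u l)) + (\<Sum>\<^sub>\<infinity>l. d * (K k l * v l))"
    by (intro infsum_add summable_on_cmult_right su sv)
  also have "\<dots> = c * matrix_op K u k + d * matrix_op K v k"
    unfolding matrix_op_def using su sv by (simp add: infsum_cmult_right)
  finally show "matrix_op K (\<lambda>k. c * u k + d * v k) k = c * matrix_op K u k + d * matrix_op K v k" .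
qed

text \<open>
  This one identity is used twice: for Schwartz \<open>F\<close> it computes the formal adjoint, and for
  tempered \<open>F\<close> it shows that the matrix satisfies the defining property of the extension to
  tempered distributions. The rapid decay of \<open>v\<close> in \<open>k\<close> and of \<open>K\<close> in \<open>k - l\<close> makes the double sum
  absolutely convergent.
\<close>
lemma matrix_op_adjoint:
  fixes K :: "int ^ 'n::finite \<Rightarrow> int ^ 'n \<Rightarrow> complex"
  assumes K: "almost_diagonal m K" and F: "F \<in> tempered" and v: "v \<in> schwartz"
  shows "(\<Sum>\<^sub>\<infinity>k. matrix_op K F k * cnj (v k))
       = (\<Sum>\<^sub>\<infinity>l. F l * cnj (matrix_op (\<lambda>l k. cnj (K k l)) v l))"
proof -
  let ?d = "2 * CARD('n)"
  obtain R where R: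
    "\<And>N. \<exists>C\<ge>0. \<forall>k l. cmod (K k l * F l) \<le> C * weight k ^ R / weight (k - l) ^ N"
    using almost_diagonal_mult_tempered[OF K F] by blast
  obtain C where C: "0 \<le> C" "\<And>k l. cmod (K k l * F l) \<le> C * weight k ^ R / weight (k - l) ^ ?d"
    using R[of ?d] by blast
  obtain B where B: "0 \<le> B" "\<And>k. cmod (v k) \<le> B / weight k ^ (R + ?d)"
    using schwartz_bound[OF v] by blast
  define Z where "Z = (\<Sum>\<^sub>\<infinity>q::int ^ 'n. 1 / weight q ^ ?d)"
  have row: "((\<lambda>l. C * B / weight k ^ ?d / weight (k - l) ^ ?d) has_sum
      C * B / weight k ^ ?d * Z) UNIV" for k :: "int ^ 'n"
    unfolding Z_def infsum_weight_translate(1)[of _ k, symmetric]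
    by (intro has_sum_infsum summable_on_weight_translate)
  have "(\<lambda>(k, l). C * B / weight k ^ ?d / weight (k - l) ^ ?d)
      summable_on ((UNIV :: (int ^ 'n) set) \<times> (UNIV :: (int ^ 'n) set))"
  proof (rule summable_on_SigmaI[where g = "\<lambda>k. C * B / weight k ^ ?d * Z"])
    show "(\<lambda>k::int ^ 'n. C * B / weight k ^ ?d * Z) summable_on UNIV"
      using summable_on_cmult_right[OF summable_on_weight[where 'n = 'n], of "C * B * Z"]
      by (simp add: mult_ac)
  qed (use row B C in auto)
  then have dbl: "(\<lambda>(k, l). K k l * F l * cnj (v k)) summable_on (UNIV \<times> UNIV)"
  proof (rule summable_on_dominated(1), safe)
    fix k l :: "int ^ 'n"
    have "cmod (K k l * F l) * cmod (v k)
        \<le> (C * weight k ^ R / weight (k - l) ^ ?d) * (B / weight k ^ (R + ?d))"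
      using B C by (intro mult_mono) auto
    also have "\<dots> = C * B / weight k ^ ?d / weight (k - l) ^ ?d"
      by (simp add: power_add field_simps)
    finally show "cmod (K k l * F l * cnj (v k)) \<le> C * B / weight k ^ ?d / weight (k - l) ^ ?d"
      by (simp add: norm_mult)
  qed
  have "(\<Sum>\<^sub>\<infinity>k. matrix_op K F k * cnj (v k)) = (\<Sum>\<^sub>\<infinity>k. \<Sum>\<^sub>\<infinity>l. K k l * F l * cnj (v k))"
    unfolding matrix_op_def
    by (intro infsum_cong infsum_cmult_left[symmetric] matrix_op_summable[OF K F])
  also have "\<dots> = (\<Sum>\<^sub>\<infinity>l. \<Sum>\<^sub>\<infinity>k. K k l * F l * cnj (v k))"
    by (rule infsum_swap_banach[OF dbl])
  also have "\<dots> = (\<Sum>\<^sub>\<infinity>l. F l * cnj (matrix_op (\<lambda>l k. cnj (K k l)) v l))"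
  proof (rule infsum_cong)
    fix l
    have "(\<Sum>\<^sub>\<infinity>k. K k l * F l * cnj (v k)) = (\<Sum>\<^sub>\<infinity>k. F l * cnj (cnj (K k l) * v k))"
      by (simp add: mult_ac)
    also have "\<dots> = F l * (\<Sum>\<^sub>\<infinity>k. cnj (cnj (K k l) * v k))"
      by (rule infsum_cmult_right')
    also have "\<dots> = F l * cnj (matrix_op (\<lambda>l k. cnj (K k l)) v l)"
      unfolding matrix_op_def infsum_cnj ..
    finally show "(\<Sum>\<^sub>\<infinity>k. K k l * F l * cnj (v k)) = F l * cnj (matrix_op (\<lambda>l k. cnj (K k l)) v l)" .
  qed
  finally show ?thesis .
qed

lemma matrix_op_adjoint_schwartz:
  fixes K :: "int ^ 'n::finite \<Rightarrow> int ^ 'n \<Rightarrow> complex"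
  assumes K: "almost_diagonal m K" and v: "v \<in> schwartz"
  shows "matrix_op (\<lambda>l k. cnj (K k l)) v \<in> schwartz"
  unfolding schwartz_iff_rapidly_decreasing rapidly_decreasing_def
proof
  fix N
  let ?d = "2 * CARD('n)"
  have one: "(\<lambda>_. 1) \<in> tempered"
    by (rule temperedI[of _ 1 0]) simp
  obtain R where R:
    "\<And>N. \<exists>C\<ge>0. \<forall>k l. cmod (K k l * 1) \<le> C * weight k ^ R / weight (k - l) ^ N"
    using almost_diagonal_mult_tempered[OF K one] by blast
  obtain C where C: "0 \<le> C" "\<And>k l. cmod (K k l) \<le> C * weight k ^ R / weight (k - l) ^ (N + ?d)"
    using R[of "N + ?d"] by auto
  obtain B where B: "0 \<le> B" "\<And>k. cmod (v k) \<le> B / weight k ^ (R + N)"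
    using schwartz_bound[OF v] by blast
  define Z where "Z = (\<Sum>\<^sub>\<infinity>q::int ^ 'n. 1 / weight q ^ ?d)"
  have "weight l ^ N * cmod (matrix_op (\<lambda>l k. cnj (K k l)) v l) \<le> C * B * Z" for l
  proof -
    have bnd: "cmod (cnj (K k l) * v k) \<le> C * B / weight l ^ N / weight (k - l) ^ ?d" for k
    proof -
      have "cmod (K k l) * cmod (v k)
          \<le> (C * weight k ^ R / weight (k - l) ^ (N + ?d)) * (B / weight k ^ (R + N))"
        using B C by (intro mult_mono) auto
      also have "\<dots> = C * B / (weight (k - l) * weight k) ^ N / weight (k - l) ^ ?d"
        by (simp add: power_add power_mult_distrib field_simps)
      also have "\<dots> \<le> C * B / weight l ^ N / weight (k - l) ^ ?d"
        using B C
        by (intro divide_right_mono divide_left_mono power_mono weight_le_diff') auto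
      finally show ?thesis by (simp add: norm_mult)
    qed
    have "cmod (matrix_op (\<lambda>l k. cnj (K k l)) v l)
        \<le> (\<Sum>\<^sub>\<infinity>k. C * B / weight l ^ N / weight (k - l) ^ ?d)"
      unfolding matrix_op_def
      by (intro summable_on_dominated(3)[OF summable_on_weight_translate(2)] bnd)
    also have "\<dots> = C * B / weight l ^ N * Z"
      unfolding Z_def by (rule infsum_weight_translate)
    finally show ?thesis
      by (simp add: field_simps)
  qed
  then show "\<exists>C. \<forall>l. weight l ^ N * cmod (matrix_op (\<lambda>l k. cnj (K k l)) v l) \<le> C"
    by blast
qed

section \<open>Almost diagonal matrices on the Hilbert spaces\<close>
lemma Hnorm_power2: "(Hnorm \<phi> u)\<^sup>2 = (\<Sum>\<^sub>\<infinity>k. (cmod (of_real (\<phi> (japanese k)) * u k))\<^sup>2)"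
  "0 \<le> Hnorm \<phi> u"
proof -
  let ?f = "\<lambda>k. (cmod (of_real (\<phi> (japanese k)) * u k))\<^sup>2"
  have 1: "of_real ((\<phi> (japanese k))\<^sup>2) * u k * cnj (u k) = complex_of_real (?f k)" for k
    by (simp add: norm_mult power_mult_distrib complex_norm_square mult.assoc flip: of_real_power)
  have "Hinner \<phi> u u = complex_of_real (infsum ?f UNIV)"
    unfolding Hinner_def 1
  proof (cases "?f summable_on UNIV")
    case True
    then show "(\<Sum>\<^sub>\<infinity>k. complex_of_real (?f k)) = complex_of_real (infsum ?f UNIV)"
      by (intro infsumI has_sum_of_real has_sum_infsum)
  next
    case False
    moreover have "\<not> (\<lambda>k. complex_of_real (?f k)) summable_on UNIV"
      using False summable_on_Re[of "\<lambda>k. complex_of_real (?f k)" UNIV] by auto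
    ultimately show "(\<Sum>\<^sub>\<infinity>k. complex_of_real (?f k)) = complex_of_real (infsum ?f UNIV)"
      by (simp add: infsum_not_exists)
  qed
  moreover have "0 \<le> infsum ?f UNIV"
    by (rule infsum_nonneg) simp
  ultimately show "(Hnorm \<phi> u)\<^sup>2 = infsum ?f UNIV" "0 \<le> Hnorm \<phi> u"
    by (simp_all add: Hnorm_def)
qed

text \<open>
  With \<open>U l = \<phi>(\<langle>l\<rangle>) |u l|\<close> and \<open>V k = \<psi>(\<langle>k\<rangle>) |(K u) k|\<close> one has \<open>V \<le> g * U\<close> for a summable \<open>g\<close>:
  the factor \<open>\<langle>k\<rangle>\<^sup>-\<^sup>m\<close> in \<open>\<psi>\<close> cancels the order \<open>m\<close> of \<open>K\<close>, and replacing \<open>\<phi>(\<langle>k\<rangle>)\<close> by \<open>\<phi>(\<langle>l\<rangle>)\<close> costs a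
  fixed power of \<open>weight (k - l)\<close>. Young's inequality does the rest.
\<close>
lemma almost_diagonal_bounded:
  fixes K :: "int ^ 'n::finite \<Rightarrow> int ^ 'n \<Rightarrow> complex"
  assumes K: "almost_diagonal m K" and \<phi>: "\<phi> \<in> RO"
  defines "\<psi> \<equiv> \<lambda>t. t powr (- m) * \<phi> t"
  obtains C where "\<And>u. u \<in> Hspace \<phi> \<Longrightarrow>
    matrix_op K u \<in> Hspace \<psi> \<and> Hnorm \<psi> (matrix_op K u) \<le> C * Hnorm \<phi> u"
proof -
  let ?d = "2 * CARD('n)"
  obtain c p where c: "1 \<le> c"
    and growth: "\<And>x y r. 1 \<le> x \<Longrightarrow> 1 \<le> y \<Longrightarrow> x \<le> r * y \<Longrightarrow> y \<le> r * x \<Longrightarrow> \<phi> x \<le> c * r ^ p * \<phi> y"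
    using RO_polynomial_growth[OF \<phi>] by blast
  \<comment> \<open>\<open>p\<close> powers of decay pay for the change of \<open>\<phi>\<close>, the remaining \<open>?d\<close> make \<open>g\<close> summable.\<close>
  obtain B where B: "\<And>k l. cmod (K k l) \<le> B * weight k powr m / weight (k - l) ^ (p + ?d)"
    using K unfolding almost_diagonal_def by meson
  define D where "D = 2 powr \<bar>m\<bar> * c * 2 ^ p * \<bar>B\<bar>"
  define g :: "int ^ 'n \<Rightarrow> real" where "g = (\<lambda>q. D / weight q ^ ?d)"
  have D0: "0 \<le> D"
    using c by (simp add: D_def)
  have g: "g summable_on UNIV" "0 \<le> g q" for q
    using summable_on_cmult_right[OF summable_on_weight[where 'n = 'n], of D] D0
    by (simp_all add: g_def)
  have \<phi>pos: "0 < \<phi> (japanese k)" for k :: "int ^ 'n"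
    using RO_pos[OF \<phi>] by simp
  have kernel: "\<psi> (japanese k) * cmod (K k l) \<le> g (k - l) * \<phi> (japanese l)" for k l
  proof -
    have 1: "\<phi> (japanese k) \<le> c * (2 * weight (k - l)) ^ p * \<phi> (japanese l)"
      using japanese_peetre[of k l] japanese_peetre[of l k]
      by (intro growth) (auto simp: weight_diff_commute)
    have 2: "japanese k powr (- m) * weight k powr m \<le> 2 powr \<bar>m\<bar>"
    proof -
      have jk: "0 < japanese k"
        using japanese_ge_1[of k] by linarith
      have q: "1 \<le> weight k / japanese k" "weight k / japanese k \<le> 2"
        using jk japanese_le_weight[of k] weight_le_japanese[of k] by (auto simp: field_simps)
      have "japanese k powr (- m) * weight k powr m = (weight k / japanese k) powr m"
        using jk by (simp add: powr_divide powr_minus field_simps)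
      also have "\<dots> \<le> (weight k / japanese k) powr \<bar>m\<bar>"
        using q by (intro powr_mono) auto
      also have "\<dots> \<le> 2 powr \<bar>m\<bar>"
        using q by (intro powr_mono2) auto
      finally show ?thesis .
    qed
    have "cmod (K k l) \<le> \<bar>B\<bar> * weight k powr m / weight (k - l) ^ (p + ?d)"
      using B[of k l] by (rule order_trans) (auto intro!: divide_right_mono mult_right_mono)
    then have "\<psi> (japanese k) * cmod (K k l)
        \<le> (japanese k powr (- m) * (c * (2 * weight (k - l)) ^ p * \<phi> (japanese l)))
          * (\<bar>B\<bar> * weight k powr m / weight (k - l) ^ (p + ?d))"
      unfolding \<psi>_def using 1 c \<phi>pos[of k] \<phi>pos[of l]
      by (intro mult_mono mult_left_mono mult_nonneg_nonneg) auto
    also have "\<dots> = (japanese k powr (- m) * weight k powr m)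
        * (c * 2 ^ p * \<bar>B\<bar> * \<phi> (japanese l) / weight (k - l) ^ ?d)"
      by (simp add: power_add power_mult_distrib field_simps)
    also have "\<dots> \<le> 2 powr \<bar>m\<bar> * (c * 2 ^ p * \<bar>B\<bar> * \<phi> (japanese l) / weight (k - l) ^ ?d)"
      using 2 c \<phi>pos[of l] by (intro mult_right_mono) auto
    also have "\<dots> = g (k - l) * \<phi> (japanese l)"
      by (simp add: g_def D_def)
    finally show ?thesis .
  qed
  have "matrix_op K u \<in> Hspace \<psi> \<and> Hnorm \<psi> (matrix_op K u) \<le> infsum g UNIV * Hnorm \<phi> u"
    if u: "u \<in> Hspace \<phi>" for u
  proof -
    define U where "U = (\<lambda>l. cmod (of_real (\<phi> (japanese l)) * u l))"
    define V where "V = (\<lambda>k. cmod (of_real (\<psi> (japanese k)) * matrix_op K u k))"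
    have ut: "u \<in> tempered" and Us: "(\<lambda>l. (U l)\<^sup>2) summable_on UNIV"
      using u by (auto simp: Hspace_def ell2_def U_def)
    have U0: "0 \<le> U l" for l
      by (simp add: U_def)
    note young = young_ell1_ell2[OF g Us U0]
    have VU: "V k \<le> (\<Sum>\<^sub>\<infinity>l. g (k - l) * U l)" for k
    proof -
      have "cmod (of_real (\<psi> (japanese k)) * (K k l * u l)) \<le> g (k - l) * U l" for l
      proof -
        have "\<psi> (japanese k) * cmod (K k l) * cmod (u l) \<le> g (k - l) * \<phi> (japanese l) * cmod (u l)"
          by (intro mult_right_mono kernel) simp
        moreover have "0 \<le> \<psi> (japanese k)"
          using \<phi>pos[of k] by (simp add: \<psi>_def)
        ultimately show ?thesis
          using \<phi>pos[of l] by (simp add: U_def norm_mult mult.assoc)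
      qed
      then have "cmod (\<Sum>\<^sub>\<infinity>l. of_real (\<psi> (japanese k)) * (K k l * u l)) \<le> (\<Sum>\<^sub>\<infinity>l. g (k - l) * U l)"
        by (intro summable_on_dominated(3) young(1))
      then show ?thesis
        by (simp add: V_def matrix_op_def infsum_cmult_right')
    qed
    have VU2: "(V k)\<^sup>2 \<le> (\<Sum>\<^sub>\<infinity>l. g (k - l) * U l)\<^sup>2" for k
      using VU[of k] by (intro power_mono) (auto simp: V_def)
    have Vs: "(\<lambda>k. (V k)\<^sup>2) summable_on UNIV"
      by (rule summable_on_dominated(1)[OF young(2)]) (use VU2 in auto)
    have "(Hnorm \<psi> (matrix_op K u))\<^sup>2 = (\<Sum>\<^sub>\<infinity>k. (V k)\<^sup>2)"
      by (simp add: Hnorm_power2 V_def)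
    also have "\<dots> \<le> (\<Sum>\<^sub>\<infinity>k. (\<Sum>\<^sub>\<infinity>l. g (k - l) * U l)\<^sup>2)"
      by (intro infsum_mono Vs young(2) VU2)
    also have "\<dots> \<le> (infsum g UNIV)\<^sup>2 * (\<Sum>\<^sub>\<infinity>l. (U l)\<^sup>2)"
      by (rule young(3))
    also have "\<dots> = (infsum g UNIV * Hnorm \<phi> u)\<^sup>2"
      by (simp add: Hnorm_power2 U_def power_mult_distrib)
    finally have "Hnorm \<psi> (matrix_op K u) \<le> infsum g UNIV * Hnorm \<phi> u"
      by (rule power2_le_imp_le) (intro mult_nonneg_nonneg infsum_nonneg g Hnorm_power2)
    moreover have "matrix_op K u \<in> Hspace \<psi>"
      using Vs matrix_op_tempered[OF K ut] by (simp add: Hspace_def ell2_def V_def)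
    ultimately show ?thesis by blast
  qed
  then show ?thesis by (rule that)
qed

lemma schwartz_subset_Hspace:
  assumes \<phi>: "\<phi> \<in> RO"
  shows "schwartz \<subseteq> (Hspace \<phi> :: (int ^ 'n::finite \<Rightarrow> complex) set)"
proof
  fix u :: "int ^ 'n \<Rightarrow> complex"
  assume u: "u \<in> schwartz"
  obtain c p where c: "1 \<le> c"
    and growth: "\<And>x y r. 1 \<le> x \<Longrightarrow> 1 \<le> y \<Longrightarrow> x \<le> r * y \<Longrightarrow> y \<le> r * x \<Longrightarrow> \<phi> x \<le> c * r ^ p * \<phi> y"
    using RO_polynomial_growth[OF \<phi>] by blast
  have pos: "0 < \<phi> t" if "1 \<le> t" for t
    using RO_pos[OF \<phi> that] .
  obtain B where B: "0 \<le> B" "\<And>k. cmod (u k) \<le> B / weight k ^ (p + CARD('n))"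
    using schwartz_bound[OF u] by blast
  have "(cmod (of_real (\<phi> (japanese k)) * u k))\<^sup>2
      \<le> (c * \<phi> 1 * B)\<^sup>2 * (1 / weight k ^ (2 * CARD('n)))" for k
  proof -
    have "\<phi> (japanese k) \<le> c * weight k ^ p * \<phi> 1"
      using japanese_le_weight[of k] weight_ge_1[of k] japanese_ge_1[of k]
        mult_mono[of 1 "weight k" 1 "japanese k"]
      by (intro growth) auto
    then have "\<phi> (japanese k) * cmod (u k) \<le> (c * weight k ^ p * \<phi> 1) * (B / weight k ^ (p + CARD('n)))"
      using B c pos[of 1] by (intro mult_mono) auto
    also have "\<dots> = c * \<phi> 1 * B / weight k ^ CARD('n)"
      by (simp add: power_add field_simps)
    finally have "(\<phi> (japanese k) * cmod (u k))\<^sup>2 \<le> (c * \<phi> 1 * B / weight k ^ CARD('n))\<^sup>2"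
      using pos[of "japanese k"] by (intro power_mono) auto
    then show ?thesis
      by (simp add: norm_mult power_mult_distrib power_divide power_mult[symmetric] mult.commute)
  qed
  then have "(\<lambda>k. (cmod (of_real (\<phi> (japanese k)) * u k))\<^sup>2) summable_on UNIV"
    by (intro summable_on_dominated(1)[OF summable_on_cmult_right[OF summable_on_weight]]) auto
  then show "u \<in> Hspace \<phi>"
    using u schwartz_subset_tempered by (auto simp: Hspace_def ell2_def)
qed

section \<open>Integration by parts on the torus\<close>
abbreviation unit_cube :: "(real ^ 'n::finite) set" where
  "unit_cube \<equiv> cbox 0 (\<chi> j. 1)"

text \<open>
  The translated cube sticks out of the unit cube by a slab; moving the slab back by one period
  fills the gap at the opposite side.
\<close>
lemma integral_unit_cube_translate:
  fixes f :: "real ^ 'n::finite \<Rightarrow> complex"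
  assumes cont: "continuous_on UNIV f" and per: "\<And>x. f (x + axis j 1) = f x"
    and t: "0 \<le> t" "t \<le> 1"
  shows "integral unit_cube (\<lambda>x. f (x + t *\<^sub>R axis j 1)) = integral unit_cube f"
proof -
  let ?e = "axis j 1 :: real ^ 'n"
  let ?one = "(\<chi> j. 1) :: real ^ 'n"
  have int: "f integrable_on cbox a b" for a b
    by (rule integrable_continuous) (rule continuous_on_subset[OF cont], simp)
  have e: "?e \<in> Basis"
    by simp
  have xe: "x \<bullet> ?e = x $ j" for x
    by (simp add: inner_axis)
  have en: "?e $ i = (if i = j then 1 else 0)" for i
    by (simp add: axis_def)
  have "integral unit_cube (\<lambda>x. f (x + t *\<^sub>R ?e)) = integral (cbox (t *\<^sub>R ?e) (?one + t *\<^sub>R ?e)) f"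
    using integral_shift_cbox[of "t *\<^sub>R ?e" "t *\<^sub>R ?e" "?one + t *\<^sub>R ?e" f] by simp
  also have "\<dots> = integral (cbox (t *\<^sub>R ?e) (?one + t *\<^sub>R ?e) \<inter> {x. x \<bullet> ?e \<le> 1}) f
      + integral (cbox (t *\<^sub>R ?e) (?one + t *\<^sub>R ?e) \<inter> {x. x \<bullet> ?e \<ge> 1}) f"
    by (rule integral_split[OF int e])
  also have "cbox (t *\<^sub>R ?e) (?one + t *\<^sub>R ?e) \<inter> {x. x \<bullet> ?e \<le> 1} = unit_cube \<inter> {x. x \<bullet> ?e \<ge> t}"
    using t by (auto simp: mem_box_cart xe en split: if_splits; smt (verit))
  also have "cbox (t *\<^sub>R ?e) (?one + t *\<^sub>R ?e) \<inter> {x. x \<bullet> ?e \<ge> 1} = cbox ?e (?one + t *\<^sub>R ?e)"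
    using t by (auto simp: mem_box_cart xe en split: if_splits; smt (verit))
  also have "integral (cbox ?e (?one + t *\<^sub>R ?e)) f = integral (cbox (?e - ?e) (?one + t *\<^sub>R ?e - ?e)) (\<lambda>x. f (x + ?e))"
    by (rule integral_shift_cbox[symmetric])
  also have "cbox (?e - ?e) (?one + t *\<^sub>R ?e - ?e) = unit_cube \<inter> {x. x \<bullet> ?e \<le> t}"
    using t by (auto simp: mem_box_cart xe en split: if_splits; smt (verit))
  also have "(\<lambda>x. f (x + ?e)) = f"
    using per by auto
  also have "integral (unit_cube \<inter> {x. x \<bullet> ?e \<ge> t}) f + integral (unit_cube \<inter> {x. x \<bullet> ?e \<le> t}) f
      = integral unit_cube f"
    using integral_split[OF int e, of 0 ?one t] by simp
  finally show ?thesis .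
qed

text \<open>
  By periodicity the integral of \<open>x \<mapsto> g (x + s e\<^sub>j)\<close> over the cube does not depend on \<open>s\<close>, and
  differentiating under the integral sign at \<open>s = 0\<close> gives the claim.
\<close>
lemma integral_directional_derivative_eq_0:
  fixes g g' :: "real ^ 'n::finite \<Rightarrow> complex"
  assumes g: "continuous_on UNIV g" and g': "continuous_on UNIV g'"
    and per: "\<And>x. g (x + axis j 1) = g x"
    and deriv: "\<And>x. ((\<lambda>t. g (x + t *\<^sub>R axis j 1)) has_vector_derivative g' x) (at 0)"
  shows "integral unit_cube g' = 0"
proof -
  let ?e = "axis j 1 :: real ^ 'n"
  have d: "((\<lambda>t. g (x + t *\<^sub>R ?e)) has_vector_derivative g' (x + s *\<^sub>R ?e)) (at s)" for x s
  proof -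
    have "((\<lambda>t. t - s) has_vector_derivative 1) (at s)"
      by (auto intro!: derivative_eq_intros)
    moreover have "((\<lambda>t. g ((x + s *\<^sub>R ?e) + t *\<^sub>R ?e)) has_vector_derivative g' (x + s *\<^sub>R ?e)) (at (s - s))"
      using deriv by simp
    ultimately have "((\<lambda>t. g ((x + s *\<^sub>R ?e) + t *\<^sub>R ?e)) \<circ> (\<lambda>t. t - s)
        has_vector_derivative (1 *\<^sub>R g' (x + s *\<^sub>R ?e))) (at s)"
      by (rule vector_diff_chain_at)
    moreover have "(\<lambda>t. g ((x + s *\<^sub>R ?e) + t *\<^sub>R ?e)) \<circ> (\<lambda>t. t - s) = (\<lambda>t. g (x + t *\<^sub>R ?e))"
      by (auto simp: fun_eq_iff algebra_simps)
    ultimately show ?thesis by simp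
  qed
  have comp: "continuous_on A (\<lambda>x. h (k x))" if "continuous_on UNIV h" "continuous_on A k"
    for h :: "real ^ 'n \<Rightarrow> complex" and k and A :: "'b::topological_space set"
    using continuous_on_compose2[OF that] by simp
  have "((\<lambda>s. integral unit_cube (\<lambda>x. g (x + s *\<^sub>R ?e))) has_vector_derivative
      integral unit_cube (\<lambda>x. g' (x + 0 *\<^sub>R ?e))) (at 0 within {0..1})"
  proof (rule leibniz_rule_vector_derivative)
    show "((\<lambda>s. g (x + s *\<^sub>R ?e)) has_vector_derivative g' (x + s *\<^sub>R ?e)) (at s within {0..1})" for x s
      using d by (rule has_vector_derivative_at_within)
    show "(\<lambda>x. g (x + s *\<^sub>R ?e)) integrable_on unit_cube" for s
      by (intro integrable_continuous comp[OF g] continuous_intros)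
    have "continuous_on ({0..1} \<times> unit_cube) (\<lambda>z. g' (snd z + fst z *\<^sub>R ?e))"
      by (intro comp[OF g'] continuous_intros)
    then show "continuous_on ({0..1} \<times> unit_cube) (\<lambda>(s, x). g' (x + s *\<^sub>R ?e))"
      by (simp add: case_prod_unfold)
  qed auto
  then have "((\<lambda>s. integral unit_cube (\<lambda>x. g (x + s *\<^sub>R ?e))) has_vector_derivative
      integral unit_cube g') (at 0 within {0..1})"
    by simp
  then have "((\<lambda>s. integral unit_cube g) has_vector_derivative integral unit_cube g') (at 0 within {0..1})"
    by (rule has_vector_derivative_transform[rotated 2]) (auto simp: integral_unit_cube_translate[OF g per])
  moreover have "((\<lambda>s::real. integral unit_cube g) has_vector_derivative 0) (at 0 within {0..1})"
    by (rule has_vector_derivative_const)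
  ultimately show ?thesis
    by (rule vector_derivative_unique_within[rotated]) (simp add: at_within_Icc_at_right)
qed

definition character :: "int ^ 'n::finite \<Rightarrow> real ^ 'n \<Rightarrow> complex" where
  "character q x = exp (2 * of_real pi * \<i> * of_real (real_vec q \<bullet> x))"

text \<open>
  The Fourier coefficient at frequency \<open>-q\<close>; this sign is the one in which \<open>psdo\<close> produces it.
\<close>
definition torus_coeff :: "(real ^ 'n::finite \<Rightarrow> complex) \<Rightarrow> int ^ 'n \<Rightarrow> complex" where
  "torus_coeff f q = integral unit_cube (\<lambda>x. character q x * f x)"

lemma norm_character [simp]: "cmod (character q x) = 1"
  by (simp add: character_def norm_exp_eq_Re)

lemma real_vec_inner_axis: "real_vec q \<bullet> (t *\<^sub>R axis j 1) = t * of_int (q $ j)"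
  by (simp add: inner_axis real_vec_def)

lemma character_periodic: "character q (x + axis j 1) = character q x"
proof -
  have "2 * of_real pi * \<i> * of_real (real_vec q \<bullet> (x + axis j 1))
      = 2 * of_real pi * \<i> * of_real (real_vec q \<bullet> x) + \<i> * (of_int (q $ j) * (of_real pi * 2))"
    using real_vec_inner_axis[of q 1 j] by (simp add: inner_add_right algebra_simps)
  then show ?thesis
    by (simp add: character_def)
qed

lemma continuous_on_character [continuous_intros]: "continuous_on A (character q)"
  unfolding character_def by (intro continuous_intros)

lemma character_has_derivative:
  "((\<lambda>t. character q (x + t *\<^sub>R axis j 1)) has_vector_derivative
     2 * of_real pi * \<i> * of_int (q $ j) * character q x) (at 0)"
proof -
  have "((\<lambda>t. exp (2 * of_real pi * \<i> * of_real (real_vec q \<bullet> x + t * of_int (q $ j))))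
      has_vector_derivative 2 * of_real pi * \<i> * of_int (q $ j) * character q x) (at 0)"
    unfolding character_def of_real_add of_real_mult
    by (rule has_vector_derivative_real_field) (auto intro!: derivative_eq_intros)
  then show ?thesis
    unfolding character_def by (simp add: inner_add_right real_vec_inner_axis[of q _ j] del: inner_scaleR_right)
qed

lemma norm_torus_coeff_le:
  assumes "continuous_on UNIV f" "0 \<le> B" "\<And>x. cmod (f x) \<le> B"
  shows "cmod (torus_coeff f q) \<le> B"
proof -
  have cont: "continuous_on unit_cube (\<lambda>x. character q x * f x)"
    by (intro continuous_intros continuous_on_subset[OF assms(1)]) auto
  have "cmod (torus_coeff f q) \<le> B * measure lborel (unit_cube :: (real ^ 'a) set)"
    unfolding torus_coeff_def
    by (rule has_integral_bound[OF assms(2) integrable_integral[OF integrable_continuous[OF cont]]])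
      (simp add: norm_mult assms(3))
  also have "measure lborel (unit_cube :: (real ^ 'a) set) = 1"
    by (subst content_cbox_cart) (auto simp: interval_eq_empty_cart)
  finally show ?thesis by simp
qed

text \<open>
  What \<open>smooth_torus\<close> says about a single coordinate direction. Only powers of one operator
  \<open>partial j\<close> occur, so invariance under \<open>Dx j l\<close> is a plain induction on the number of derivatives.
\<close>
definition smooth_along :: "'n::finite \<Rightarrow> (real ^ 'n \<Rightarrow> complex) \<Rightarrow> bool" where
  "smooth_along j f \<longleftrightarrow>
     (\<forall>i. continuous_on UNIV ((partial j ^^ i) f) \<and>
        (\<forall>x. (\<lambda>t. (partial j ^^ i) f (x + t *\<^sub>R axis j 1)) differentiable (at 0))) \<and>
     (\<forall>x. f (x + axis j 1) = f x)"

lemma smooth_torus_smooth_along: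
  assumes "f \<in> smooth_torus"
  shows "smooth_along j f"
proof -
  have iter: "foldr partial (replicate i j) f = (partial j ^^ i) f" for i
    by (induction i) auto
  have "smooth f" and per: "\<And>x. f (x + axis j 1) = f x"
    using assms by (auto simp: smooth_torus_def)
  then have "continuous_on UNIV (foldr partial (replicate i j) f)"
    "(\<lambda>t. foldr partial (replicate i j) f (x + t *\<^sub>R axis j 1)) differentiable (at 0)" for i x
    unfolding smooth_def by blast+
  with per show ?thesis
    unfolding smooth_along_def iter by blast
qed

lemma smooth_alongD:
  assumes "smooth_along j f"
  shows "continuous_on UNIV f"
    and "f (x + axis j 1) = f x"
    and "((\<lambda>t. f (x + t *\<^sub>R axis j 1)) has_vector_derivative partial j f x) (at 0)"
proof -
  have 0: "continuous_on UNIV ((partial j ^^ 0) f)"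
      "(\<lambda>t. (partial j ^^ 0) f (x + t *\<^sub>R axis j 1)) differentiable (at 0)"
    using assms unfolding smooth_along_def by blast+
  show "continuous_on UNIV f"
    using 0(1) by simp
  show "f (x + axis j 1) = f x"
    using assms unfolding smooth_along_def by blast
  show "((\<lambda>t. f (x + t *\<^sub>R axis j 1)) has_vector_derivative partial j f x) (at 0)"
    using 0(2) unfolding partial_def by (simp add: vector_derivative_works)
qed

lemma smooth_along_partial:
  assumes "smooth_along j f"
  shows "smooth_along j (partial j f)"
proof -
  have per: "f (x + axis j 1) = f x" for x
    by (rule smooth_alongD[OF assms])
  have "f (x + axis j 1 + t *\<^sub>R axis j 1) = f (x + t *\<^sub>R axis j 1)" for x t
    using per[of "x + t *\<^sub>R axis j 1"] by (simp add: add_ac)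
  then have "partial j f (x + axis j 1) = partial j f x" for x
    by (simp add: partial_def)
  moreover have "(partial j ^^ i) (partial j f) = (partial j ^^ Suc i) f" for i
    by (simp add: funpow_swap1)
  ultimately show ?thesis
    using assms unfolding smooth_along_def by metis
qed

lemma smooth_along_linear_combination:
  assumes f: "smooth_along j f" and g: "smooth_along j g"
  shows "smooth_along j (\<lambda>x. c * f x - d * g x)"
proof -
  have f_i: "smooth_along j ((partial j ^^ i) f)" and g_i: "smooth_along j ((partial j ^^ i) g)" for i
    by (induction i) (auto simp: f g smooth_along_partial)
  have deriv: "((\<lambda>t. c * (partial j ^^ i) f (x + t *\<^sub>R axis j 1) - d * (partial j ^^ i) g (x + t *\<^sub>R axis j 1))
      has_vector_derivative c * (partial j ^^ Suc i) f x - d * (partial j ^^ Suc i) g x) (at 0)" for i x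
    using smooth_alongD(3)[OF f_i] smooth_alongD(3)[OF g_i]
    by (auto intro!: has_vector_derivative_diff has_vector_derivative_mult_right)
  have iter: "(partial j ^^ i) (\<lambda>x. c * f x - d * g x)
      = (\<lambda>x. c * (partial j ^^ i) f x - d * (partial j ^^ i) g x)" for i
  proof (induction i)
    case (Suc i)
    have "(partial j ^^ Suc i) (\<lambda>x. c * f x - d * g x)
        = partial j (\<lambda>x. c * (partial j ^^ i) f x - d * (partial j ^^ i) g x)"
      by (simp add: Suc)
    also have "\<dots> = (\<lambda>x. c * (partial j ^^ Suc i) f x - d * (partial j ^^ Suc i) g x)"
      unfolding partial_def[of j "\<lambda>x. c * (partial j ^^ i) f x - d * (partial j ^^ i) g x"]
      by (rule ext) (rule vector_derivative_at[OF deriv])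
    finally show ?case .
  qed simp
  show ?thesis
    unfolding smooth_along_def iter
  proof (intro conjI allI)
    show "continuous_on UNIV (\<lambda>x. c * (partial j ^^ i) f x - d * (partial j ^^ i) g x)" for i
      by (intro continuous_intros smooth_alongD(1)[OF f_i] smooth_alongD(1)[OF g_i])
    show "(\<lambda>t. c * (partial j ^^ i) f (x + t *\<^sub>R axis j 1) - d * (partial j ^^ i) g (x + t *\<^sub>R axis j 1))
        differentiable (at 0)" for i x
      using deriv by (rule differentiableI_vector)
    show "c * f (x + axis j 1) - d * g (x + axis j 1) = c * f x - d * g x" for x
      by (simp add: smooth_alongD(2)[OF f] smooth_alongD(2)[OF g])
  qed
qed

lemma smooth_along_Dx:
  assumes "smooth_along j f"
  shows "smooth_along j (Dx j l f)"
proof (induction l)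
  case (Suc l)
  then show ?case
    by (simp only: Dx.simps) (intro smooth_along_linear_combination smooth_along_partial)
qed (simp add: assms)

lemma torus_coeff_partial:
  assumes "smooth_along j f"
  shows "torus_coeff (partial j f) q = - (2 * of_real pi * \<i> * of_int (q $ j)) * torus_coeff f q"
proof -
  note f = smooth_alongD[OF assms]
  note pf = smooth_alongD[OF smooth_along_partial[OF assms]]
  let ?c = "2 * of_real pi * \<i> * of_int (q $ j)"
  have "integral unit_cube (\<lambda>x. character q x * partial j f x + ?c * character q x * f x) = 0"
  proof (rule integral_directional_derivative_eq_0)
    show "continuous_on UNIV (\<lambda>x. character q x * f x)"
      "continuous_on UNIV (\<lambda>x. character q x * partial j f x + ?c * character q x * f x)"
      by (intro continuous_intros f(1) pf(1))+
    show "character q (x + axis j 1) * f (x + axis j 1) = character q x * f x" for x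
      by (simp add: character_periodic f(2))
    show "((\<lambda>t. character q (x + t *\<^sub>R axis j 1) * f (x + t *\<^sub>R axis j 1)) has_vector_derivative
        character q x * partial j f x + ?c * character q x * f x) (at 0)" for x
      using has_vector_derivative_mult[OF character_has_derivative[of q x j] f(3)[of x]] by simp
  qed
  moreover have "integral unit_cube (\<lambda>x. character q x * partial j f x + ?c * (character q x * f x))
      = torus_coeff (partial j f) q + ?c * torus_coeff f q"
  proof -
    have "(\<lambda>x. character q x * partial j f x) integrable_on unit_cube"
      "(\<lambda>x. ?c * (character q x * f x)) integrable_on unit_cube"
      by (intro integrable_continuous continuous_intros continuous_on_subset[OF f(1)]
          continuous_on_subset[OF pf(1)] subset_UNIV)+
    then show ?thesis
      unfolding torus_coeff_def by (subst Henstock_Kurzweil_Integration.integral_add) auto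
  qed
  ultimately show ?thesis
    by (simp add: mult.assoc add_eq_0_iff)
qed

text \<open>
  The operator \<open>Dx j l\<close> is a falling factorial in \<open>\<partial>\<^sub>j / (2 \<pi> \<i>)\<close>, which acts on the coefficient as
  multiplication by \<open>- q\<^sub>j\<close>.
\<close>
lemma torus_coeff_Dx:
  assumes "smooth_along j f"
  shows "torus_coeff (Dx j l f) q = (\<Prod>r<l. - of_int (q $ j + int r)) * torus_coeff f q"
proof (induction l)
  case (Suc l)
  let ?h = "Dx j l f"
  note h = smooth_along_Dx[OF assms, of l]
  note hc = smooth_alongD(1)[OF h] smooth_alongD(1)[OF smooth_along_partial[OF h]]
  have "torus_coeff (Dx j (Suc l) f) q
      = integral unit_cube (\<lambda>x. 1 / (2 * of_real pi * \<i>) * (character q x * partial j ?h x)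
          - of_nat l * (character q x * ?h x))"
    unfolding torus_coeff_def by (simp add: algebra_simps)
  also have "\<dots> = 1 / (2 * of_real pi * \<i>) * torus_coeff (partial j ?h) q - of_nat l * torus_coeff ?h q"
  proof -
    have "(\<lambda>x. 1 / (2 * of_real pi * \<i>) * (character q x * partial j ?h x)) integrable_on unit_cube"
      "(\<lambda>x. of_nat l * (character q x * ?h x)) integrable_on unit_cube"
      by (intro integrable_continuous continuous_intros continuous_on_subset[OF hc(1)]
          continuous_on_subset[OF hc(2)] subset_UNIV)+
    then show ?thesis
      unfolding torus_coeff_def by (subst Henstock_Kurzweil_Integration.integral_diff) auto
  qed
  also have "\<dots> = - of_int (q $ j + int l) * torus_coeff ?h q"
    by (simp add: torus_coeff_partial[OF h] field_simps)
  finally show ?case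
    by (simp add: Suc mult_ac)
qed simp

text \<open>
  The multiplier of \<open>Dx j N\<close> vanishes at \<open>q = 0, -1, \<dots>, 1 - N\<close>, and therefore alone does not
  control \<open>|q|\<^sup>N\<close>. Those finitely many values are covered by the summand 1, which stands for the
  estimate without derivatives; for \<open>|q| \<ge> N\<close> every factor is at least \<open>|q| / N\<close>.
\<close>
lemma power_le_rising_product:
  fixes q :: int
  shows "\<bar>real_of_int q\<bar> ^ N \<le> real N ^ N * (1 + (\<Prod>r<N. \<bar>real_of_int (q + int r)\<bar>))"
proof (cases "\<bar>q\<bar> < int N")
  case True
  then have "\<bar>real_of_int q\<bar> \<le> real N"
    by linarith
  then have "\<bar>real_of_int q\<bar> ^ N \<le> real N ^ N"
    by (intro power_mono) auto
  also have "\<dots> \<le> real N ^ N * (1 + (\<Prod>r<N. \<bar>real_of_int (q + int r)\<bar>))"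
    by (auto simp: algebra_simps intro!: mult_nonneg_nonneg prod_nonneg)
  finally show ?thesis .
next
  case False
  have "\<bar>real_of_int q\<bar> \<le> real N * \<bar>real_of_int (q + int r)\<bar>" if r: "r < N" for r
  proof -
    have "real N \<le> \<bar>real_of_int q\<bar>"
      using False by linarith
    then have "(real N - 1) * \<bar>real_of_int q\<bar> \<ge> (real N - 1) * real N"
      using r by (intro mult_left_mono) auto
    moreover have "real N * \<bar>real_of_int (q + int r)\<bar> \<ge> real N * (\<bar>real_of_int q\<bar> - (real N - 1))"
      using r by (intro mult_left_mono) auto
    ultimately show ?thesis
      by (simp add: algebra_simps)
  qed
  then have "(\<Prod>r<N. \<bar>real_of_int q\<bar>) \<le> (\<Prod>r<N. real N * \<bar>real_of_int (q + int r)\<bar>)"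
    by (intro prod_mono) auto
  then have "\<bar>real_of_int q\<bar> ^ N \<le> real N ^ N * (\<Prod>r<N. \<bar>real_of_int (q + int r)\<bar>)"
    by (simp add: prod.distrib)
  also have "\<dots> \<le> real N ^ N * (1 + (\<Prod>r<N. \<bar>real_of_int (q + int r)\<bar>))"
    by (intro mult_left_mono) auto
  finally show ?thesis .
qed

lemma torus_coeff_decay:
  fixes f :: "real ^ 'n::finite \<Rightarrow> complex"
  assumes f: "\<And>j. smooth_along j f"
    and B: "\<And>x. cmod (f x) \<le> B" and D: "\<And>j x. cmod (Dx j N f x) \<le> D j"
  shows "weight q ^ N * cmod (torus_coeff f q)
    \<le> (1 + real CARD('n)) ^ N * (B + (\<Sum>j\<in>(UNIV :: 'n set). real N ^ N * (B + D j)))"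
proof -
  have B0: "0 \<le> B"
    using B[of 0] norm_ge_zero by (rule order_trans[rotated])
  have D0: "0 \<le> D j" for j
    using D[of j 0] norm_ge_zero by (rule order_trans[rotated])
  have tf: "cmod (torus_coeff f q) \<le> B"
    by (intro norm_torus_coeff_le smooth_alongD(1)[OF f] B B0)
  have comp: "\<bar>real_of_int (q $ j)\<bar> ^ N * cmod (torus_coeff f q) \<le> real N ^ N * (B + D j)" for j
  proof -
    have "\<bar>real_of_int (q $ j)\<bar> ^ N * cmod (torus_coeff f q)
        \<le> real N ^ N * (1 + (\<Prod>r<N. \<bar>real_of_int (q $ j + int r)\<bar>)) * cmod (torus_coeff f q)"
      by (intro mult_right_mono power_le_rising_product) simp
    also have "\<dots> = real N ^ N * (cmod (torus_coeff f q) + cmod (torus_coeff (Dx j N f) q))"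
    proof -
      have "cmod (torus_coeff (Dx j N f) q)
          = (\<Prod>r<N. \<bar>real_of_int (q $ j + int r)\<bar>) * cmod (torus_coeff f q)"
        unfolding torus_coeff_Dx[OF f] norm_mult prod_norm[symmetric] norm_minus_cancel norm_of_int ..
      then show ?thesis by (simp add: algebra_simps)
    qed
    also have "\<dots> \<le> real N ^ N * (B + D j)"
      by (intro mult_left_mono add_mono tf norm_torus_coeff_le smooth_alongD(1)[OF smooth_along_Dx[OF f]] D D0)
        simp
    finally show ?thesis .
  qed
  have "weight q ^ N * cmod (torus_coeff f q) \<le>
      (1 + real CARD('n)) ^ N * (1 + (\<Sum>j\<in>UNIV. \<bar>real_of_int (q $ j)\<bar> ^ N)) * cmod (torus_coeff f q)"
    by (intro mult_right_mono weight_power_le) simp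
  also have "\<dots> = (1 + real CARD('n)) ^ N * (cmod (torus_coeff f q)
      + (\<Sum>j\<in>UNIV. \<bar>real_of_int (q $ j)\<bar> ^ N * cmod (torus_coeff f q)))"
    by (simp add: algebra_simps sum_distrib_left sum_distrib_right)
  also have "\<dots> \<le> (1 + real CARD('n)) ^ N * (B + (\<Sum>j\<in>(UNIV :: 'n set). real N ^ N * (B + D j)))"
    by (intro mult_left_mono add_mono sum_mono tf comp) simp
  finally show ?thesis .
qed

lemma multi_Dx_axis:
  fixes j :: "'n::finite"
  shows "multi_Dx (axis j N) f = Dx j N f"
proof -
  have "foldr (\<lambda>i. Dx i (axis j N $ i)) js f = (if j \<in> set js then Dx j N f else f)"
    if "distinct js" for js :: "'n list"
    using that by (induction js) (auto simp: axis_def)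
  then show ?thesis
    by (simp add: multi_Dx_def distinct_coords set_coords)
qed

lemma multi_Dx_0: "multi_Dx (0 :: nat ^ 'n::finite) f = f"
proof -
  have "foldr (\<lambda>i. Dx i ((0 :: nat ^ 'n) $ i)) js f = f" for js
    by (induction js) auto
  then show ?thesis by (simp add: multi_Dx_def)
qed

section \<open>Pseudo-differential operators as almost diagonal matrices\<close>
definition symbol_kernel ::
    "(int ^ 'n::finite \<Rightarrow> real ^ 'n \<Rightarrow> complex) \<Rightarrow> int ^ 'n \<Rightarrow> int ^ 'n \<Rightarrow> complex" where
  "symbol_kernel a k l = torus_coeff (a k) (k - l)"

lemma symbol_smooth_along:
  assumes "a \<in> symbol_class m"
  shows "smooth_along j (a k)"
  using assms by (auto simp: symbol_class_def intro: smooth_torus_smooth_along)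

lemma almost_diagonal_symbol_kernel:
  fixes a :: "int ^ 'n::finite \<Rightarrow> real ^ 'n \<Rightarrow> complex"
  assumes a: "a \<in> symbol_class m"
  shows "almost_diagonal m (symbol_kernel a)"
  unfolding almost_diagonal_def
proof
  fix N
  have sym: "\<exists>C. \<forall>k x. cmod (multi_Dx \<beta> (a k) x) \<le> C * weight k powr m" for \<beta>
  proof -
    obtain C where "\<And>k x. cmod (multi_Dx \<beta> (\<lambda>y. multi_diff 0 (\<lambda>l. a l y) k) x)
        \<le> C * (1 + lnorm k) powr (m - real (multi_order (0 :: nat ^ 'n)))"
      using a unfolding symbol_class_def by blast
    then show ?thesis
      by (auto simp: multi_diff_0 multi_order_def weight_def)
  qed
  obtain B where B: "\<And>k x. cmod (a k x) \<le> B * weight k powr m"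
    using sym[of 0] by (auto simp: multi_Dx_0)
  have "\<forall>j. \<exists>C. \<forall>k x. cmod (Dx j N (a k) x) \<le> C * weight k powr m"
    using sym[of "axis j N" for j] by (simp add: multi_Dx_axis)
  then obtain D where D: "\<And>j k x. cmod (Dx j N (a k) x) \<le> D j * weight k powr m"
    by metis
  define C where "C = (1 + real CARD('n)) ^ N * (B + (\<Sum>j\<in>(UNIV :: 'n set). real N ^ N * (B + D j)))"
  have "cmod (symbol_kernel a k l) \<le> C * weight k powr m / weight (k - l) ^ N" for k l
  proof -
    have "weight (k - l) ^ N * cmod (symbol_kernel a k l)
      \<le> (1 + real CARD('n)) ^ N * (B * weight k powr m
        + (\<Sum>j\<in>(UNIV :: 'n set). real N ^ N * (B * weight k powr m + D j * weight k powr m)))"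
      unfolding symbol_kernel_def by (intro torus_coeff_decay symbol_smooth_along[OF a] B D)
    also have "\<dots> = C * weight k powr m"
      by (simp add: C_def sum_distrib_left sum_distrib_right algebra_simps)
    finally show ?thesis
      by (simp add: field_simps)
  qed
  then show "\<exists>C. \<forall>k l. cmod (symbol_kernel a k l) \<le> C * weight k powr m / weight (k - l) ^ N"
    by blast
qed

lemma schwartz_summable:
  assumes "u \<in> schwartz"
  shows "(\<lambda>l. c * cmod (u l)) summable_on UNIV"
proof -
  obtain B where "\<And>k. cmod (u k) \<le> B / weight k ^ (2 * CARD('a))"
    using schwartz_bound[OF assms] by blast
  then have "(\<lambda>l. cmod (u l)) summable_on UNIV"
    by (intro summable_on_dominated(1)[OF summable_on_cmult_right[OF summable_on_weight, of B]]) simp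
  then show ?thesis
    by (rule summable_on_cmult_right)
qed

text \<open>
  The Fourier series of a Schwartz sequence converges uniformly by the Weierstrass test, so that it
  may be integrated term by term.
\<close>
lemma psdo_eq_matrix_op:
  fixes u :: "int ^ 'n::finite \<Rightarrow> complex"
  assumes a: "a \<in> symbol_class m" and u: "u \<in> schwartz"
  shows "psdo a u = matrix_op (symbol_kernel a) u"
proof
  fix k
  define h where "h l x = character k x * a k x * (character (- l) x * u l)" for l x
  define g where "g x = (\<Sum>\<^sub>\<infinity>l. h l x)" for x
  have ac: "continuous_on A (a k)" for A
    using smooth_alongD(1)[OF symbol_smooth_along[OF a]] continuous_on_subset by blast
  have h_cont: "continuous_on A (h l)" for A l
    unfolding h_def by (intro continuous_intros ac)
  have compact: "compact (unit_cube :: (real ^ 'n) set)"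
    by (rule compact_cbox)
  obtain M where M: "\<And>x. x \<in> unit_cube \<Longrightarrow> cmod (a k x) \<le> M"
    using compact_imp_bounded[OF compact_continuous_image[OF ac compact]]
    unfolding bounded_iff by blast
  have lim: "uniform_limit unit_cube (\<lambda>F x. \<Sum>l\<in>F. h l x) g (finite_subsets_at_top UNIV)"
    unfolding g_def
  proof (rule Weierstrass_m_test_general)
    show "cmod (h l x) \<le> M * cmod (u l)" if "x \<in> unit_cube" for l x
      using M[OF that] by (simp add: h_def norm_mult mult_right_mono)
  qed (rule schwartz_summable[OF u])
  have g_cont: "continuous_on unit_cube g"
    by (rule uniform_limit_theorem[OF _ lim])
      (auto intro!: always_eventually continuous_on_sum h_cont)
  have g_eq: "exp (2 * of_real pi * \<i> * of_real (real_vec k \<bullet> x)) * a k x * fourier u x = g x" for x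
  proof -
    have "real_vec (- l) \<bullet> x = - (real_vec l \<bullet> x)" for l
      by (simp add: real_vec_def inner_vec_def sum_negf)
    then have "fourier u x = (\<Sum>\<^sub>\<infinity>l. character (- l) x * u l)"
      by (simp add: fourier_def character_def)
    then show ?thesis
      by (simp add: g_def h_def infsum_cmult_right' character_def)
  qed
  have h_int: "(h l has_integral symbol_kernel a k l * u l) unit_cube" for l
  proof -
    have prod: "character k x * character (- l) x = character (k - l) x" for x
      by (simp add: character_def real_vec_def inner_vec_def sum_subtractf sum_negf algebra_simps
          flip: exp_add)
    have "h l = (\<lambda>x. character (k - l) x * a k x * u l)"
      by (auto simp: h_def prod[symmetric])
    moreover have "((\<lambda>x. character (k - l) x * a k x) has_integral symbol_kernel a k l) unit_cube"
      unfolding symbol_kernel_def torus_coeff_def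
      by (intro integrable_integral integrable_continuous continuous_intros ac)
    ultimately show ?thesis
      using has_integral_mult_left by metis
  qed
  obtain I J where I: "\<And>F. ((\<lambda>x. \<Sum>l\<in>F. h l x) has_integral I F) unit_cube"
    and J: "(g has_integral J) unit_cube" and IJ: "(I \<longlongrightarrow> J) (finite_subsets_at_top UNIV)"
    by (rule uniform_limit_integral_cbox[OF lim]) (auto intro!: continuous_on_sum h_cont)
  have "\<forall>\<^sub>F F in finite_subsets_at_top UNIV. I F = (\<Sum>l\<in>F. symbol_kernel a k l * u l)"
  proof (rule eventually_finite_subsets_at_top_weakI)
    fix F :: "(int ^ 'n) set"
    assume "finite F"
    then have "((\<lambda>x. \<Sum>l\<in>F. h l x) has_integral (\<Sum>l\<in>F. symbol_kernel a k l * u l)) unit_cube"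
      by (intro has_integral_sum h_int)
    with I[of F] show "I F = (\<Sum>l\<in>F. symbol_kernel a k l * u l)"
      by (rule has_integral_unique)
  qed
  then have "((\<lambda>l. symbol_kernel a k l * u l) has_sum J) UNIV"
    unfolding has_sum_def using IJ by (rule Lim_transform_eventually[rotated])
  then have "matrix_op (symbol_kernel a) u k = J"
    unfolding matrix_op_def by (rule infsumI)
  also have "J = integral unit_cube g"
    using J by (simp add: integral_unique)
  also have "\<dots> = (LINT x:unit_cube|lborel. g x)"
    using borel_integrable_compact[OF compact g_cont]
    by (intro set_borel_integral_eq_integral(2)[symmetric]) (simp add: set_integrable_def)
  also have "\<dots> = psdo a u k"
    by (simp add: psdo_def g_eq)
  finally show "psdo a u k = matrix_op (symbol_kernel a) u k"
    by simp
qed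

text \<open>
  Testing against the unit sequences, which are Schwartz, determines a sequence entry by entry;
  this gives the uniqueness behind the definite descriptions in \<open>formal_adjoint\<close> and
  \<open>psdo_tempered\<close>.
\<close>
lemma formal_adjoint_eq:
  fixes v :: "int ^ 'n::finite \<Rightarrow> complex"
  assumes a: "a \<in> symbol_class m" and v: "v \<in> schwartz"
  shows "formal_adjoint a v = matrix_op (\<lambda>l k. cnj (symbol_kernel a k l)) v"
  unfolding formal_adjoint_def
proof (rule the_equality)
  note K = almost_diagonal_symbol_kernel[OF a]
  let ?w = "matrix_op (\<lambda>l k. cnj (symbol_kernel a k l)) v"
  have adj: "ell2_inner (psdo a u) v = ell2_inner u ?w" if "u \<in> schwartz" for u
    using matrix_op_adjoint[OF K _ v, of u] that schwartz_subset_tempered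
    by (auto simp: ell2_inner_def psdo_eq_matrix_op[OF a that])
  then show "?w \<in> schwartz \<and> (\<forall>u\<in>schwartz. ell2_inner (psdo a u) v = ell2_inner u ?w)"
    using matrix_op_adjoint_schwartz[OF K v] by blast
  fix w
  assume w: "w \<in> schwartz \<and> (\<forall>u\<in>schwartz. ell2_inner (psdo a u) v = ell2_inner u w)"
  have delta: "ell2_inner (unit_sequence l) w = cnj (w l)" for l and w :: "int ^ 'n \<Rightarrow> complex"
    using infsum_unit_sequence[of "\<lambda>k. cnj (w k)" l] by (simp add: ell2_inner_def mult.commute)
  have "cnj (w l) = cnj (?w l)" for l
    using w adj[OF unit_sequence_schwartz] unit_sequence_schwartz delta by metis
  then show "w = ?w"
    by (metis complex_cnj_cancel_iff ext)
qed

lemma psdo_tempered_eq: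
  fixes F :: "int ^ 'n::finite \<Rightarrow> complex"
  assumes a: "a \<in> symbol_class m" and F: "F \<in> tempered"
  shows "psdo_tempered a F = matrix_op (symbol_kernel a) F"
  unfolding psdo_tempered_def
proof (rule the_equality)
  note K = almost_diagonal_symbol_kernel[OF a]
  let ?G = "matrix_op (symbol_kernel a) F"
  have dual: "dual_pairing ?G (\<lambda>k. cnj (u k)) = dual_pairing F (\<lambda>k. cnj (formal_adjoint a u k))"
    if "u \<in> schwartz" for u
    using matrix_op_adjoint[OF K F that] by (simp add: dual_pairing_def formal_adjoint_eq[OF a that])
  then show "?G \<in> tempered \<and> (\<forall>u\<in>schwartz.
      dual_pairing ?G (\<lambda>k. cnj (u k)) = dual_pairing F (\<lambda>k. cnj (formal_adjoint a u k)))"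
    using matrix_op_tempered[OF K F] by blast
  fix G
  assume G: "G \<in> tempered \<and> (\<forall>u\<in>schwartz.
      dual_pairing G (\<lambda>k. cnj (u k)) = dual_pairing F (\<lambda>k. cnj (formal_adjoint a u k)))"
  have delta: "dual_pairing G (\<lambda>k. cnj (unit_sequence l k)) = G l" for l and G :: "int ^ 'n \<Rightarrow> complex"
    by (simp add: dual_pairing_def infsum_unit_sequence)
  have "G l = ?G l" for l
    using G dual[OF unit_sequence_schwartz[of l]] unit_sequence_schwartz[of l] delta by metis
  then show "G = ?G"
    by (rule ext)
qed

theorem theorem2p5:
  fixes m :: real
    and a :: "int ^ 'n::finite \<Rightarrow> real ^ 'n \<Rightarrow> complex"
    and \<phi> :: "real \<Rightarrow> real"
  assumes "a \<in> symbol_class m"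
    and "\<phi> \<in> RO"
  defines "\<psi> \<equiv> \<lambda>t. t powr (- m) * \<phi> t"
  shows "schwartz \<subseteq> (Hspace \<phi> :: (int ^ 'n \<Rightarrow> complex) set)
    \<and> (\<forall>u\<in>schwartz. psdo_tempered a u = psdo a u)
    \<and> (\<forall>u\<in>Hspace \<phi>. psdo_tempered a u \<in> Hspace \<psi>)
    \<and> (\<forall>u\<in>Hspace \<phi>. \<forall>v\<in>Hspace \<phi>. \<forall>c d.
         psdo_tempered a (\<lambda>k. c * u k + d * v k)
           = (\<lambda>k. c * psdo_tempered a u k + d * psdo_tempered a v k))
    \<and> (\<exists>C. \<forall>u\<in>Hspace \<phi>. Hnorm \<psi> (psdo_tempered a u) \<le> C * Hnorm \<phi> u)"
proof -
  note K = almost_diagonal_symbol_kernel[OF assms(1)]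
  note ext = psdo_tempered_eq[OF assms(1)]
  have H: "u \<in> tempered" if "u \<in> Hspace \<phi>" for u :: "int ^ 'n \<Rightarrow> complex"
    using that by (simp add: Hspace_def)
  obtain C where C: "\<And>u. u \<in> Hspace \<phi> \<Longrightarrow> matrix_op (symbol_kernel a) u \<in> Hspace \<psi>
      \<and> Hnorm \<psi> (matrix_op (symbol_kernel a) u) \<le> C * Hnorm \<phi> u"
    using almost_diagonal_bounded[OF K assms(2)] unfolding \<psi>_def by blast
  show ?thesis
  proof (intro conjI ballI allI exI[of _ C])
    show "schwartz \<subseteq> (Hspace \<phi> :: (int ^ 'n \<Rightarrow> complex) set)"
      by (rule schwartz_subset_Hspace[OF assms(2)])
    show "psdo_tempered a u = psdo a u" if "u \<in> schwartz" for u
      using that schwartz_subset_tempered by (auto simp: ext psdo_eq_matrix_op[OF assms(1)])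
    show "psdo_tempered a u \<in> Hspace \<psi>" "Hnorm \<psi> (psdo_tempered a u) \<le> C * Hnorm \<phi> u"
      if "u \<in> Hspace \<phi>" for u
      using C[OF that] by (simp_all add: ext H that)
    show "psdo_tempered a (\<lambda>k. c * u k + d * v k)
        = (\<lambda>k. c * psdo_tempered a u k + d * psdo_tempered a v k)"
      if "u \<in> Hspace \<phi>" "v \<in> Hspace \<phi>" for u v c d
      using H[OF that(1)] H[OF that(2)]
      by (simp add: ext tempered_lincomb matrix_op_lincomb[OF K])
  qed
qed

end
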